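(* Let $m,n,k$ be non-negative integers with $1\le k\le n$. (1) For positive integers $1<b_2<\dots<b_k$ with $b_k\le m+k$, the sum over all $(m,n,k)$-Gog trapezoids with bottom row $(1,b_2,\dots,b_k)$ of $P^{\#\text{minima}}Q^{\#\text{maxima not including }b_k}$ equals the constant term in $x_1,\dots,x_n$ of $$P(1+Px_1)^{-1}(1+x_1)^2x_1^{-n+1}\prod_{i=2}^k(1+x_i)^{b_i}x_i^{-n+1}\prod_{i=k+1}^n(1+Qx_i)(1+x_i)^{m+k}x_i^{-n+i-k}\prod_{1\le i<j\le n}(x_i-x_j)(1+x_j+x_ix_j).$$ (2) For positive integers $b_1<\dots<b_k$ with $b_k\le m+k$, the sum over all $(m,n,k)$-Gog trapezoids with bottom row $(b_1,\dots,b_k)$ of $Q^{\#\text{maxima not including }b_k}$ equals the constant term of $$\prod_{i=1}^k(1+x_i)^{b_i}x_i^{-n+1}\prod_{i=k+1}^n(1+Qx_i)(1+x_i)^{m+k}x_i^{-n+i-k}\prod_{1\le i<j\le n}(x_i-x_j)(1+x_j+x_ix_j).$$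
   Context: For non-negative integers $m,n,k$ with $k\le n$, an $(m,n,k)$-Gog trapezoid is an array $(m_{i,j})$ of positive integers indexed by $1\le i\le n$, $1\le j\le\min(i,k)$ (the $k$ leftmost NE-diagonals of a triangular array with $n$ rows), such that $m_{i+1,j}\le m_{i,j}\le m_{i+1,j+1}$ whenever the entries exist, rows are strictly increasing, and $m_{i,j}\le m+n-i+j$ (the upper bound for the entries of its SE-diagonal). Bottom row: $(m_{n,1},\dots,m_{n,k})$. A minimum is an entry equal to $1$. A maximum is an entry $m_{i,k}$ of the $k$-th NE-diagonal with $m_{i,k}=m+n-i+k$. "Maxima not including $b_k$" means the bottom entry $m_{n,k}=b_k$ is not counted even if it is a maximum. $P,Q$ are indeterminates; $(1+Px_1)^{-1}$ is expanded as a power series in $x_1$. *)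

theory Defs
  imports
    "HOL-Library.Poly_Mapping"
    "HOL-Computational_Algebra.Computational_Algebra"
begin

subsection \<open>Gog trapezoids\<close>

definition gog_positions :: "nat \<Rightarrow> nat \<Rightarrow> (nat \<times> nat) set" where
  "gog_positions n k = {(i, j). 1 \<le> i \<and> i \<le> n \<and> 1 \<le> j \<and> j \<le> min i k}"

text \<open>An array is a function of row and NE-diagonal. It is set to 0 away from the positions of the
  trapezoid, so that each trapezoid is represented by exactly one function.\<close>

definition gog_trapezoid :: "nat \<Rightarrow> nat \<Rightarrow> nat \<Rightarrow> (nat \<Rightarrow> nat \<Rightarrow> nat) \<Rightarrow> bool" where
  "gog_trapezoid m n k a \<longleftrightarrow>
     (\<forall>i j. (i, j) \<notin> gog_positions n k \<longrightarrow> a i j = 0) \<and>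
     (\<forall>(i, j) \<in> gog_positions n k. 0 < a i j) \<and>
     (\<forall>(i, j) \<in> gog_positions n k. (i + 1, j) \<in> gog_positions n k \<longrightarrow> a (i + 1) j \<le> a i j) \<and>
     (\<forall>(i, j) \<in> gog_positions n k.
        (i + 1, j + 1) \<in> gog_positions n k \<longrightarrow> a i j \<le> a (i + 1) (j + 1)) \<and>
     (\<forall>(i, j) \<in> gog_positions n k. (i, j + 1) \<in> gog_positions n k \<longrightarrow> a i j < a i (j + 1)) \<and>
     (\<forall>(i, j) \<in> gog_positions n k. a i j \<le> m + n - i + j)"

definition gog_with_bottom ::
    "nat \<Rightarrow> nat \<Rightarrow> nat \<Rightarrow> (nat \<Rightarrow> nat) \<Rightarrow> (nat \<Rightarrow> nat \<Rightarrow> nat) set" where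
  "gog_with_bottom m n k b = {a. gog_trapezoid m n k a \<and> (\<forall>j\<in>{1..k}. a n j = b j)}"

definition num_minima :: "nat \<Rightarrow> nat \<Rightarrow> (nat \<Rightarrow> nat \<Rightarrow> nat) \<Rightarrow> nat" where
  "num_minima n k a = card {(i, j) \<in> gog_positions n k. a i j = 1}"

text \<open>The bottom row \<open>i = n\<close> is left out: the entry \<open>b\<^sub>k\<close> is never counted.\<close>

definition num_maxima_above_bottom :: "nat \<Rightarrow> nat \<Rightarrow> nat \<Rightarrow> (nat \<Rightarrow> nat \<Rightarrow> nat) \<Rightarrow> nat" where
  "num_maxima_above_bottom m n k a = card {i \<in> {k..<n}. a i k = m + n - i + k}"

lemma finite_gog_positions: "finite (gog_positions n k)"
  by (rule finite_subset[of _ "{..n} \<times> {..k}"]) (auto simp: gog_positions_def)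

lemma finite_gog_with_bottom: "finite (gog_with_bottom m n k b)"
proof (rule finite_subset)
  let ?F = "{f. \<forall>p. (p \<in> gog_positions n k \<longrightarrow> f p \<in> {..m + n + k}) \<and>
                     (p \<notin> gog_positions n k \<longrightarrow> f p = 0)}"
  show "finite (curry ` ?F)"
    by (intro finite_imageI finite_set_of_finite_funs finite_gog_positions) simp
  show "gog_with_bottom m n k b \<subseteq> curry ` ?F"
  proof
    fix a assume a: "a \<in> gog_with_bottom m n k b"
    have "a i j \<le> m + n + k" if "(i, j) \<in> gog_positions n k" for i j
    proof -
      have "a i j \<le> m + n - i + j"
        using a that unfolding gog_with_bottom_def gog_trapezoid_def by blast
      moreover have "j \<le> k"
        using that by (simp add: gog_positions_def)
      ultimately show ?thesis
        by linarith
    qed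
    moreover have "a i j = 0" if "(i, j) \<notin> gog_positions n k" for i j
      using a that unfolding gog_with_bottom_def gog_trapezoid_def by blast
    ultimately have "case_prod a \<in> ?F"
      by auto
    then have "curry (case_prod a) \<in> curry ` ?F"
      by (rule imageI)
    then show "a \<in> curry ` ?F"
      by (simp only: curry_case_prod)
  qed
qed

subsection \<open>Laurent series and constant terms\<close>

text \<open>The coefficients lie in the polynomial ring \<open>\<int>[P, Q]\<close>.\<close>

type_synonym coeffs = "int poly poly"

definition indet_P :: coeffs where "indet_P = [:[:0, 1:]:]"

definition indet_Q :: coeffs where "indet_Q = [:0, 1:]"

text \<open>The formulas only involve Laurent polynomials in \<open>x\<^sub>1, x\<^sub>2, \<dots>\<close> and the power series
  \<open>(1 + P x\<^sub>1)\<^sup>-\<^sup>1\<close> in \<open>x\<^sub>1\<close>. Both live in the ring of formal Laurent series in \<open>x\<^sub>1\<close> whose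
  coefficients are Laurent polynomials in the variables \<open>x\<^sub>i\<close> with \<open>i \<noteq> 1\<close>; such a Laurent
  polynomial is a finitely supported function on exponent vectors.\<close>

type_synonym laurent = "((nat \<Rightarrow>\<^sub>0 int) \<Rightarrow>\<^sub>0 coeffs) fls"

definition scal :: "coeffs \<Rightarrow> laurent" where
  "scal c = fls_const (Poly_Mapping.single 0 c)"

text \<open>The monomial \<open>x\<^sub>i\<^sup>e\<close> for an integer exponent \<open>e\<close>.\<close>

definition xpow :: "nat \<Rightarrow> int \<Rightarrow> laurent" where
  "xpow i e =
     (if i = 1 then fls_X_intpow e
      else fls_const (Poly_Mapping.single (Poly_Mapping.single i e) 1))"

definition xvar :: "nat \<Rightarrow> laurent" where
  "xvar i = xpow i 1"

definition inverse_one_plus_P_x1 :: laurent where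
  "inverse_one_plus_P_x1 = fps_to_fls (Abs_fps (\<lambda>r. Poly_Mapping.single 0 ((- indet_P) ^ r)))"

definition const_term :: "laurent \<Rightarrow> coeffs" where
  "const_term F = Poly_Mapping.lookup (fls_nth F 0) 0"

lemma inverse_one_plus_P_x1: "(1 + scal indet_P * xvar 1) * inverse_one_plus_P_x1 = 1"
proof -
  define c :: "(nat \<Rightarrow>\<^sub>0 int) \<Rightarrow>\<^sub>0 coeffs" where "c = Poly_Mapping.single 0 indet_P"
  define G :: "((nat \<Rightarrow>\<^sub>0 int) \<Rightarrow>\<^sub>0 coeffs) fps"
    where "G = Abs_fps (\<lambda>r. Poly_Mapping.single 0 ((- indet_P) ^ r))"
  have G_0: "fps_nth G 0 = 1"
    by (simp add: G_def)
  have G_Suc: "fps_nth G (Suc r) = - (c * fps_nth G r)" for r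
    by (simp add: G_def c_def mult_single single_uminus)
  have "(1 + fps_const c * fps_X) * G = G + fps_const c * (fps_X * G)"
    by (simp only: distrib_right mult_1_left mult.assoc)
  also have "\<dots> = 1"
  proof (rule fps_ext)
    fix r
    show "fps_nth (G + fps_const c * (fps_X * G)) r = fps_nth 1 r"
      by (cases r) (simp_all add: G_0 G_Suc)
  qed
  finally have *: "(1 + fps_const c * fps_X) * G = 1" .
  have "1 + scal indet_P * xvar 1 = fps_to_fls (1 + fps_const c * fps_X)"
    by (simp add: scal_def xvar_def xpow_def c_def fls_times_fps_to_fls fls_X_conv_shift_1)
  then have "(1 + scal indet_P * xvar 1) * inverse_one_plus_P_x1 =
      fps_to_fls ((1 + fps_const c * fps_X) * G)"
    by (simp only: inverse_one_plus_P_x1_def G_def fls_times_fps_to_fls)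
  then show ?thesis
    by (simp add: *)
qed

lemma xpow_0: "xpow i 0 = 1"
  by (simp add: xpow_def)

lemma xpow_mult: "xpow i d * xpow i e = xpow i (d + e)"
proof (cases "i = 1")
  case True
  then show ?thesis
    by (simp only: xpow_def refl if_True fls_X_intpow_times_fls_X_intpow)
next
  case False
  then show ?thesis
    by (simp only: xpow_def if_False fls_const_mult_const mult_single single_add mult_1_left)
qed

end

theory Submission
  imports Defs
begin

text \<open>Write \<open>X\<^sub>i = 1 + x\<^sub>i\<close>. Both sides satisfy the same recursion, obtained by removing the bottom
  row of the trapezoid, respectively one variable from the constant term.

  Expand the Vandermonde factor \<open>\<Prod>\<^sub>i\<^sub><\<^sub>j (x\<^sub>i - x\<^sub>j)\<close> along its top power: only the variables of
  maximal exponent \<open>n - 1\<close> can carry that power, and picking \<open>x\<^sub>i\<close> amounts to setting \<open>x\<^sub>i = 0\<close> in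
  everything else. The factors \<open>1 + x\<^sub>j + x\<^sub>i x\<^sub>j\<close> then become 1 or \<open>X\<^sub>j\<close>, so the constant term
  becomes an alternating sum over \<open>i\<close> of products of \<open>X\<^sub>j^b\<^sub>j\<close> for \<open>j < i\<close> and \<open>X\<^sub>j^(b\<^sub>j\<^sub>+\<^sub>1 + 1)\<close>
  for \<open>j \<ge> i\<close>. Summing instead over the rows interlacing with \<open>b\<close> gives geometric sums with
  numerators \<open>X\<^sub>j^(b\<^sub>j\<^sub>+\<^sub>1 + 1) - X\<^sub>j^b\<^sub>j\<close>, corrected for ties. The surplus terms are multiples of
  \<open>(X\<^sub>j X\<^sub>j\<^sub>+\<^sub>1)^b\<^sub>j\<^sub>+\<^sub>1 (1 + x\<^sub>j + x\<^sub>j x\<^sub>j\<^sub>+\<^sub>1)\<close>, and these have constant term 0, since they make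
  the integrand antisymmetric in \<open>x\<^sub>j\<close> and \<open>x\<^sub>j\<^sub>+\<^sub>1\<close>.

  Minima and maxima only change the two ends of the row. At the right end,
  \<open>(1 + Q x) X^(m + k + 1)\<close> replaces \<open>X^(m + k + 1)\<close>. At the left end, the factor
  \<open>D = P X\<^sup>2 / (1 + P x)\<close> of a leading entry 1 satisfies \<open>P (x D - X\<^sup>2) = - D\<close>, so it behaves like the
  lower term of a geometric sum.\<close>

subsection \<open>Multivariate polynomials\<close>

type_synonym 'a mpoly = "(nat \<Rightarrow>\<^sub>0 nat) \<Rightarrow>\<^sub>0 'a"

definition Const :: "'a::comm_ring_1 \<Rightarrow> 'a mpoly" where
  "Const c = Poly_Mapping.single 0 c"

definition Var :: "nat \<Rightarrow> 'a::comm_ring_1 mpoly" where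
  "Var i = Poly_Mapping.single (Poly_Mapping.single i 1) 1"

definition monom_eval :: "(nat \<Rightarrow> 'r::comm_ring_1) \<Rightarrow> (nat \<Rightarrow>\<^sub>0 nat) \<Rightarrow> 'r" where
  "monom_eval s a = (\<Prod>i\<in>Poly_Mapping.keys a. s i ^ Poly_Mapping.lookup a i)"

definition eval_mpoly ::
    "('a::comm_ring_1 \<Rightarrow> 'r::comm_ring_1) \<Rightarrow> (nat \<Rightarrow> 'r) \<Rightarrow> 'a mpoly \<Rightarrow> 'r" where
  "eval_mpoly c s p =
     (\<Sum>a\<in>Poly_Mapping.keys p. c (Poly_Mapping.lookup p a) * monom_eval s a)"

lemma sum_single_keys:
  "(\<Sum>a\<in>Poly_Mapping.keys p. Poly_Mapping.single a (Poly_Mapping.lookup p a)) = p"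
  by (rule poly_mapping_eqI)
    (simp add: lookup_sum lookup_single when_def in_keys_iff cong: conj_cong)

lemma monom_eval_superset:
  assumes "finite S" "Poly_Mapping.keys a \<subseteq> S"
  shows "monom_eval s a = (\<Prod>i\<in>S. s i ^ Poly_Mapping.lookup a i)"
  unfolding monom_eval_def
  by (rule prod.mono_neutral_left[OF assms]) (auto simp: in_keys_iff)

lemma monom_eval_0 [simp]: "monom_eval s 0 = 1"
  by (simp add: monom_eval_def)

lemma monom_eval_single [simp]: "monom_eval s (Poly_Mapping.single i e) = s i ^ e"
  by (simp add: monom_eval_def)

lemma monom_eval_add: "monom_eval s (a + b) = monom_eval s a * monom_eval s b"
proof -
  let ?S = "Poly_Mapping.keys a \<union> Poly_Mapping.keys b"
  have "monom_eval s (a + b) = (\<Prod>i\<in>?S. s i ^ Poly_Mapping.lookup (a + b) i)"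
    by (rule monom_eval_superset) (auto simp: in_keys_iff lookup_add)
  also have "\<dots> = monom_eval s a * monom_eval s b"
    by (simp add: lookup_add power_add prod.distrib monom_eval_superset[of ?S])
  finally show ?thesis .
qed

lemma single_sum_one:
  "finite A \<Longrightarrow> Poly_Mapping.single (\<Sum>i\<in>A. f i) 1 =
      (\<Prod>i\<in>A. Poly_Mapping.single (f i) (1::'a::comm_ring_1))"
proof (induction A rule: finite_induct)
  case (insert i A)
  then show ?case
    by (simp flip: insert.IH add: mult_single)
qed simp

lemma Var_power: "(Var i :: 'a::comm_ring_1 mpoly) ^ e =
    Poly_Mapping.single (Poly_Mapping.single i e) 1"
  by (induction e) (simp_all add: Var_def mult_single flip: single_add)

lemma Const_0 [simp]: "Const 0 = 0" and Const_1 [simp]: "Const 1 = 1"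
  by (simp_all add: Const_def)

lemma Const_mult: "Const (a * b) = Const a * Const b"
  by (simp add: Const_def mult_single)

lemma Const_add: "Const (a + b) = Const a + Const b"
  by (simp add: Const_def single_add)

lemma Const_uminus: "Const (- a) = - Const a"
  by (simp add: Const_def single_uminus)

lemma Const_power: "Const (a ^ e) = Const a ^ e"
  by (induction e) (simp_all add: Const_mult)

lemma lookup_Const_mult: "Poly_Mapping.lookup (Const c * p) e = c * Poly_Mapping.lookup p e"
  unfolding Const_def mult_map_scale_conv_mult[symmetric]
  by (simp add: Poly_Mapping.map.rep_eq when_def)

text \<open>The universal property of the polynomial ring: a homomorphism \<open>c\<close> on
  coefficients together with values \<open>s\<close> for the variables extends to a homomorphism. It
  is instantiated with \<open>Const\<close> for substitutions and with \<open>scal\<close> for the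
  passage to Laurent series.\<close>

locale coeff_hom =
  fixes c :: "'a::comm_ring_1 \<Rightarrow> 'r::comm_ring_1"
  assumes c_add: "c (x + y) = c x + c y"
    and c_mult: "c (x * y) = c x * c y"
    and c_1: "c 1 = 1"
begin

lemma c_0: "c 0 = 0"
  using c_add[of 0 0] by simp

abbreviation "ev \<equiv> eval_mpoly c"

lemma ev_superset:
  assumes "finite S" "Poly_Mapping.keys p \<subseteq> S"
  shows "ev s p = (\<Sum>a\<in>S. c (Poly_Mapping.lookup p a) * monom_eval s a)"
  unfolding eval_mpoly_def
  by (rule sum.mono_neutral_left[OF assms]) (auto simp: in_keys_iff c_0)

lemma ev_add: "ev s (p + q) = ev s p + ev s q"
proof -
  let ?S = "Poly_Mapping.keys p \<union> Poly_Mapping.keys q"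
  have "ev s (p + q) = (\<Sum>a\<in>?S. c (Poly_Mapping.lookup (p + q) a) * monom_eval s a)"
    by (rule ev_superset) (auto simp: in_keys_iff lookup_add)
  also have "\<dots> = ev s p + ev s q"
    by (simp add: lookup_add c_add distrib_right sum.distrib ev_superset[of ?S])
  finally show ?thesis .
qed

lemma ev_0 [simp]: "ev s 0 = 0"
  by (simp add: eval_mpoly_def)

lemma ev_single [simp]: "ev s (Poly_Mapping.single a x) = c x * monom_eval s a"
  by (simp add: eval_mpoly_def c_0)

lemma ev_Const [simp]: "ev s (Const x) = c x"
  by (simp add: Const_def)

lemma ev_Var [simp]: "ev s (Var i) = s i"
  by (simp add: Var_def c_1)

lemma ev_sum: "ev s (sum f A) = (\<Sum>i\<in>A. ev s (f i))"
  by (induction A rule: infinite_finite_induct) (simp_all add: ev_add)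

lemma ev_1 [simp]: "ev s 1 = 1"
  using ev_single[of s 0 1] by (simp add: c_1)

lemma ev_mult: "ev s (p * q) = ev s p * ev s q"
proof -
  have "p * q = (\<Sum>a\<in>Poly_Mapping.keys p. Poly_Mapping.single a (Poly_Mapping.lookup p a)) *
      (\<Sum>b\<in>Poly_Mapping.keys q. Poly_Mapping.single b (Poly_Mapping.lookup q b))"
    by (simp only: sum_single_keys)
  also have "\<dots> = (\<Sum>a\<in>Poly_Mapping.keys p. \<Sum>b\<in>Poly_Mapping.keys q.
      Poly_Mapping.single (a + b) (Poly_Mapping.lookup p a * Poly_Mapping.lookup q b))"
    by (simp only: sum_product mult_single)
  finally have "ev s (p * q) = (\<Sum>a\<in>Poly_Mapping.keys p. \<Sum>b\<in>Poly_Mapping.keys q.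
      c (Poly_Mapping.lookup p a * Poly_Mapping.lookup q b) * monom_eval s (a + b))"
    by (simp only: ev_sum ev_single)
  then show ?thesis
    by (simp add: c_mult monom_eval_add eval_mpoly_def sum_product mult_ac)
qed

lemma ev_uminus: "ev s (- p) = - ev s p"
  using ev_add[of s p "- p"] by (simp add: eq_neg_iff_add_eq_0 add.commute)

lemma ev_diff: "ev s (p - q) = ev s p - ev s q"
  using ev_add[of s p "- q"] by (simp add: ev_uminus)

lemma ev_power: "ev s (p ^ e) = ev s p ^ e"
  by (induction e) (simp_all add: ev_mult)

lemma ev_prod: "ev s (prod f A) = (\<Prod>i\<in>A. ev s (f i))"
  by (induction A rule: infinite_finite_induct) (simp_all add: ev_mult)

lemmas ev_simps = ev_add ev_mult ev_uminus ev_diff ev_power ev_prod ev_sum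

end

section \<open>Substitutions that rename or delete variables\<close>

abbreviation subst :: "(nat \<Rightarrow> 'a::comm_ring_1 mpoly) \<Rightarrow> 'a mpoly \<Rightarrow> 'a mpoly" where
  "subst \<equiv> eval_mpoly Const"

interpretation subst: coeff_hom Const
  by unfold_locales (simp_all add: Const_add Const_mult)

text \<open>Variables in \<open>Z\<close> are set to 0 and the others are renamed bijectively by
  \<open>d\<close>. A monomial either vanishes or becomes a monomial again, and the only exponent
  vector sent to \<open>e\<close> is the pullback \<open>e0\<close> of \<open>e\<close> along
  \<open>d\<close>, extended by 0 on \<open>Z\<close>.\<close>

lemma lookup_monom_eval_renaming:
  fixes d :: "nat \<Rightarrow> nat"
  assumes d: "bij_betw d (- Z) UNIV"
    and e0: "\<And>j. j \<in> Z \<Longrightarrow> Poly_Mapping.lookup e0 j = 0"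
    and e1: "\<And>j. j \<notin> Z \<Longrightarrow> Poly_Mapping.lookup e0 j = Poly_Mapping.lookup e (d j)"
  shows "Poly_Mapping.lookup
      (monom_eval (\<lambda>j. if j \<in> Z then 0 else Var (d j)) a :: 'a::comm_ring_1 mpoly) e =
    (1 when a = e0)"
proof (cases "\<exists>j\<in>Z. Poly_Mapping.lookup a j \<noteq> 0")
  case True
  then obtain j where j: "j \<in> Z" "Poly_Mapping.lookup a j \<noteq> 0"
    by blast
  then have "monom_eval (\<lambda>j. if j \<in> Z then 0 else Var (d j)) a = (0 :: 'a mpoly)"
    unfolding monom_eval_def by (intro prod_zero bexI[of _ j]) (auto simp: in_keys_iff zero_power)
  then show ?thesis
    using j e0 by (auto simp: when_def)
next
  case False
  let ?b = "\<Sum>j\<in>Poly_Mapping.keys a. Poly_Mapping.single (d j) (Poly_Mapping.lookup a j)"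
  have "monom_eval (\<lambda>j. if j \<in> Z then 0 else Var (d j)) a =
      (\<Prod>j\<in>Poly_Mapping.keys a. (Var (d j) :: 'a mpoly) ^ Poly_Mapping.lookup a j)"
    unfolding monom_eval_def using False by (intro prod.cong) (auto simp: in_keys_iff)
  also have "\<dots> = Poly_Mapping.single ?b 1"
    by (simp add: Var_power single_sum_one)
  finally have eq: "monom_eval (\<lambda>j. if j \<in> Z then 0 else Var (d j)) a =
      (Poly_Mapping.single ?b 1 :: 'a mpoly)" .
  have b: "Poly_Mapping.lookup ?b (d j) = Poly_Mapping.lookup a j" if "j \<notin> Z" for j
  proof -
    have "d i = d j \<longleftrightarrow> i = j" if "i \<in> Poly_Mapping.keys a" for i
      using d that False \<open>j \<notin> Z\<close> by (auto simp: bij_betw_def inj_on_def in_keys_iff)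
    then have "Poly_Mapping.lookup ?b (d j) =
        (\<Sum>i\<in>Poly_Mapping.keys a. Poly_Mapping.lookup a i when i = j)"
      by (simp add: lookup_sum lookup_single)
    also have "\<dots> = Poly_Mapping.lookup a j"
      by (simp add: when_def in_keys_iff)
    finally show ?thesis .
  qed
  have "?b = e \<longleftrightarrow> a = e0"
  proof
    assume "?b = e"
    then have "Poly_Mapping.lookup a j = Poly_Mapping.lookup e0 j" for j
      using False e0 e1 b by (cases "j \<in> Z") auto
    then show "a = e0"
      by (simp add: poly_mapping_eqI)
  next
    assume a: "a = e0"
    show "?b = e"
    proof (rule poly_mapping_eqI)
      fix i
      obtain j where "j \<notin> Z" "i = d j"
        using d by (force simp: bij_betw_def)
      then show "Poly_Mapping.lookup ?b i = Poly_Mapping.lookup e i"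
        using b a e1 by metis
    qed
  qed
  then show ?thesis
    by (simp add: eq lookup_single)
qed

text \<open>The monomial case, extended linearly. It serves with empty \<open>Z\<close> to exchange
  two variables and with a singleton \<open>Z\<close> to delete one.\<close>

lemma lookup_subst_renaming:
  fixes d :: "nat \<Rightarrow> nat"
  assumes "bij_betw d (- Z) UNIV"
    and "\<And>j. j \<in> Z \<Longrightarrow> Poly_Mapping.lookup e0 j = 0"
    and "\<And>j. j \<notin> Z \<Longrightarrow> Poly_Mapping.lookup e0 j = Poly_Mapping.lookup e (d j)"
  shows "Poly_Mapping.lookup (subst (\<lambda>j. if j \<in> Z then 0 else Var (d j)) p) e =
    Poly_Mapping.lookup p e0"
proof -
  have "Poly_Mapping.lookup (subst (\<lambda>j. if j \<in> Z then 0 else Var (d j)) p) e =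
      (\<Sum>a\<in>Poly_Mapping.keys p. Poly_Mapping.lookup p a * (1 when a = e0))"
    by (simp add: eval_mpoly_def lookup_sum lookup_Const_mult
        lookup_monom_eval_renaming[OF assms])
  also have "\<dots> = Poly_Mapping.lookup p e0"
    by (simp only: mult_when) (simp add: when_def in_keys_iff)
  finally show ?thesis .
qed

lemma lookup_monom_mult:
  fixes p :: "'a::comm_ring_1 mpoly"
  shows "Poly_Mapping.lookup (p * Poly_Mapping.single a 1) (e + a) = Poly_Mapping.lookup p e"
proof -
  have "p * Poly_Mapping.single a 1 =
      (\<Sum>b\<in>Poly_Mapping.keys p. Poly_Mapping.single b
          (Poly_Mapping.lookup p b)) * Poly_Mapping.single a 1"
    by (simp only: sum_single_keys)
  also have "\<dots> = (\<Sum>b\<in>Poly_Mapping.keys p. Poly_Mapping.single (b + a) (Poly_Mapping.lookup p b))"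
    by (simp add: sum_distrib_right mult_single)
  finally show ?thesis
    by (simp add: lookup_sum lookup_single when_def in_keys_iff)
qed

lemma lookup_mult_Var_power_eq_0:
  fixes p :: "'a::comm_ring_1 mpoly"
  assumes "Poly_Mapping.lookup e i < N"
  shows "Poly_Mapping.lookup (p * Var i ^ N) e = 0"
proof -
  have "p * Var i ^ N = (\<Sum>b\<in>Poly_Mapping.keys p. Poly_Mapping.single b (Poly_Mapping.lookup p b)) *
      Poly_Mapping.single (Poly_Mapping.single i N) 1"
    by (simp only: sum_single_keys Var_power)
  also have "\<dots> = (\<Sum>b\<in>Poly_Mapping.keys p.
      Poly_Mapping.single (b + Poly_Mapping.single i N) (Poly_Mapping.lookup p b))"
    by (simp add: sum_distrib_right mult_single)
  also have "Poly_Mapping.lookup \<dots> e = 0"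
  proof -
    have "b + Poly_Mapping.single i N \<noteq> e" for b
      using assms by (auto simp: lookup_add)
    then show ?thesis
      by (simp add: lookup_sum lookup_single)
  qed
  finally show ?thesis .
qed

subsection \<open>The kernel\<close>

text \<open>The index set is arbitrary rather than \<open>{1..n}\<close>, since expanding the
  Vandermonde product deletes an index before the remaining ones are renumbered.\<close>

definition pairs :: "nat set \<Rightarrow> (nat \<times> nat) set" where
  "pairs S = {(a, b). a \<in> S \<and> b \<in> S \<and> a < b}"

definition vand :: "(nat \<Rightarrow> 'a::comm_ring_1) \<Rightarrow> nat set \<Rightarrow> 'a" where
  "vand z S = (\<Prod>(a, b)\<in>pairs S. z a - z b)"

definition kern :: "(nat \<Rightarrow> 'a::comm_ring_1) \<Rightarrow> nat set \<Rightarrow> 'a" where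
  "kern z S = (\<Prod>(a, b)\<in>pairs S. 1 + z b + z a * z b)"

lemma finite_pairs [simp]: "finite S \<Longrightarrow> finite (pairs S)"
  by (rule finite_subset[of _ "S \<times> S"]) (auto simp: pairs_def)

lemma prod_pairs_remove:
  assumes "finite S" "i \<in> S"
  shows "prod f (pairs S) = prod f (pairs (S - {i})) *
    (\<Prod>a\<in>{a\<in>S. a < i}. f (a, i)) * (\<Prod>b\<in>{b\<in>S. i < b}. f (i, b))"
proof -
  let ?A = "(\<lambda>a. (a, i)) ` {a\<in>S. a < i}" and ?B = "(\<lambda>b. (i, b)) ` {b\<in>S. i < b}"
  have fin: "finite (pairs (S - {i}))"
    using assms by simp
  have "pairs S = pairs (S - {i}) \<union> ?A \<union> ?B"
    using assms by (auto simp: pairs_def)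
  also have "prod f \<dots> = prod f (pairs (S - {i}) \<union> ?A) * prod f ?B"
    using assms fin by (intro prod.union_disjoint) (auto simp: pairs_def)
  also have "prod f (pairs (S - {i}) \<union> ?A) = prod f (pairs (S - {i})) * prod f ?A"
    using assms fin by (intro prod.union_disjoint) (auto simp: pairs_def)
  finally show ?thesis
    by (simp add: prod.reindex inj_on_def)
qed

text \<open>The sign comes from the pairs \<open>(a, i)\<close> with \<open>a < i\<close>, in which
  \<open>z i\<close> is the subtracted term.\<close>

lemma vand_remove:
  assumes "finite S" "i \<in> S"
  shows "vand z S = (- 1) ^ card {a\<in>S. a < i} * vand z (S - {i}) * (\<Prod>j\<in>S - {i}. z i - z j)"
proof -
  have "(\<Prod>a\<in>{a\<in>S. a < i}. z a - z i) = (\<Prod>a\<in>{a\<in>S. a < i}. - (z i - z a))"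
    by simp
  also have "\<dots> = (- 1) ^ card {a\<in>S. a < i} * (\<Prod>a\<in>{a\<in>S. a < i}. z i - z a)"
    by (simp only: prod_uminus)
  finally have 1: "(\<Prod>a\<in>{a\<in>S. a < i}. z a - z i) =
    (- 1) ^ card {a\<in>S. a < i} * (\<Prod>a\<in>{a\<in>S. a < i}. z i - z a)" .
  have "S - {i} = {a\<in>S. a < i} \<union> {b\<in>S. i < b}"
    by auto
  then have "(\<Prod>j\<in>S - {i}. z i - z j) = (\<Prod>j\<in>{a\<in>S. a < i} \<union> {b\<in>S. i < b}. z i - z j)"
    by simp
  also have "\<dots> = (\<Prod>a\<in>{a\<in>S. a < i}. z i - z a) * (\<Prod>b\<in>{b\<in>S. i < b}. z i - z b)"
    using assms by (intro prod.union_disjoint) auto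
  finally show ?thesis
    unfolding vand_def prod_pairs_remove[OF assms] by (simp add: 1 mult_ac)
qed

text \<open>Interpolate the polynomial \<open>t\<^sup>n\<^sup>-\<^sup>1\<close> at the \<open>n\<close> points \<open>z i\<close>
    and compare leading coefficients.\<close>

lemma vand_expand:
  fixes z :: "nat \<Rightarrow> 'a::idom"
  assumes S: "finite S" "card S = Suc N" and inj: "inj_on z S"
  shows "vand z S = (\<Sum>i\<in>S. (- 1) ^ card {a\<in>S. a < i} * z i ^ N * vand z (S - {i}))"
proof -
  \<comment> \<open>The interpolated polynomial is \<open>vand z S\<close> times the power of degree
    \<open>N\<close>, so no division occurs: at \<open>z i\<close> the polynomial \<open>L i\<close>
    takes the value by which \<open>vand z (S - {i})\<close> differs from \<open>vand z S\<close> up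
    to sign, and it vanishes at the other points.\<close>
  define c where "c i = (- 1) ^ card {a\<in>S. a < i} * z i ^ N * vand z (S - {i})" for i
  define L where "L i = (\<Prod>j\<in>S - {i}. [:- z j, 1:])" for i
  have deg: "degree (L i) = N" and lead: "coeff (L i) N = 1" if "i \<in> S" for i
  proof -
    show "degree (L i) = N"
      unfolding L_def using S that by (subst degree_prod_eq_sum_degree) auto
    then show "coeff (L i) N = 1"
      using lead_coeff_prod[of "\<lambda>j. [:- z j, 1:]" "S - {i}"] by (simp add: L_def)
  qed
  have "(\<Sum>i\<in>S. smult (c i) (L i)) = smult (vand z S) (monom 1 N)"
  proof (rule poly_eqI_degree[of "z ` S"])
    show "poly (\<Sum>i\<in>S. smult (c i) (L i)) x = poly (smult (vand z S) (monom 1 N)) x"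
      if "x \<in> z ` S" for x
    proof -
      from that obtain i where i: "i \<in> S" "x = z i"
        by blast
      have "c l * poly (L l) x = (if l = i then vand z S * z i ^ N else 0)" if "l \<in> S" for l
      proof (cases "l = i")
        case True
        then show ?thesis
          using vand_remove[OF S(1) i(1), of z] by (simp add: c_def L_def poly_prod i mult_ac)
      next
        case False
        then have "poly (L l) x = 0"
          unfolding L_def poly_prod i(2) using i S by (intro prod_zero) (auto intro!: bexI[of _ i])
        with False show ?thesis
          by simp
      qed
      then show ?thesis
        using S i by (simp add: poly_sum poly_monom)
    qed
    have card: "card (z ` S) = Suc N"
      using S inj by (simp add: card_image)
    show "degree (\<Sum>i\<in>S. smult (c i) (L i)) < card (z ` S)"
      unfolding card less_Suc_eq_le using S deg
      by (intro degree_sum_le) (auto intro: order.trans[OF degree_smult_le])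
    show "degree (smult (vand z S) (monom 1 N)) < card (z ` S)"
      unfolding card less_Suc_eq_le
      by (intro order.trans[OF degree_smult_le] degree_monom_le)
  qed
  then have "coeff (\<Sum>i\<in>S. smult (c i) (L i)) N = coeff (smult (vand z S) (monom 1 N)) N"
    by simp
  then show ?thesis
    by (simp add: coeff_sum lead c_def)
qed

text \<open>A strictly increasing renumbering keeps the order within each pair, so the arguments of
  \<open>g\<close> are never exchanged. This is what closing the gap after a deleted index
  requires.\<close>

lemma prod_pairs_strict_mono:
  assumes "strict_mono_on S d"
  shows "(\<Prod>(a, b)\<in>pairs S. g (d a) (d b)) = (\<Prod>(a, b)\<in>pairs (d ` S). g a b)"
proof (rule prod.reindex_bij_witness[of _ "map_prod (inv_into S d) (inv_into S d)" "map_prod d d"])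
  have inj: "inj_on d S"
    using assms by (rule strict_mono_on_imp_inj_on)
  show "map_prod (inv_into S d) (inv_into S d) (map_prod d d p) = p" if "p \<in> pairs S" for p
    using that inj by (auto simp: pairs_def)
  show "map_prod d d p \<in> pairs (d ` S)" if "p \<in> pairs S" for p
    using that assms by (auto simp: pairs_def strict_mono_on_def)
  show "map_prod d d (map_prod (inv_into S d) (inv_into S d) p) = p" if "p \<in> pairs (d ` S)" for p
    using that by (auto simp: pairs_def f_inv_into_f)
  show "map_prod (inv_into S d) (inv_into S d) p \<in> pairs S" if "p \<in> pairs (d ` S)" for p
    using that assms inj strict_mono_on_less[OF assms] by (auto simp: pairs_def)
qed auto

section \<open>Exchanging two adjacent variables\<close>

abbreviation swap :: "nat \<Rightarrow> nat \<Rightarrow> nat" where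
  "swap j i \<equiv> (if i = j then Suc j else if i = Suc j then j else i)"

text \<open>An adjacent transposition preserves the order within every pair other than
  \<open>(j, Suc j)\<close>, hence permutes the remaining pairs.\<close>

lemma prod_pairs_swap:
  assumes "finite S" "j \<in> S" "Suc j \<in> S"
  shows "(\<Prod>(a, b)\<in>pairs S - {(j, Suc j)}. g (swap j a) (swap j b)) =
    (\<Prod>(a, b)\<in>pairs S - {(j, Suc j)}. g a b)"
  by (rule prod.reindex_bij_witness[of _ "map_prod (swap j) (swap j)" "map_prod (swap j) (swap j)"])
    (use assms in \<open>auto simp: pairs_def split: if_splits\<close>)

lemma vand_swap:
  assumes "finite S" "j \<in> S" "Suc j \<in> S"
  shows "vand (\<lambda>i. z (swap j i)) S = - vand z S"
proof -
  have "(j, Suc j) \<in> pairs S"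
    using assms by (simp add: pairs_def)
  then show ?thesis
    using prod_pairs_swap[OF assms, of "\<lambda>a b. z a - z b"] assms
    unfolding vand_def by (simp add: prod.remove[of _ "(j, Suc j)"] flip: mult_minus_left)
qed

text \<open>Only the factor of the pair \<open>(j, Suc j)\<close> changes. The identity is
  cross-multiplied because that factor cannot be divided out in a general ring.\<close>

lemma kern_swap:
  assumes "finite S" "j \<in> S" "Suc j \<in> S"
  shows "kern (\<lambda>i. z (swap j i)) S * (1 + z (Suc j) + z j * z (Suc j)) =
    kern z S * (1 + z j + z j * z (Suc j))"
proof -
  have "(j, Suc j) \<in> pairs S"
    using assms by (simp add: pairs_def)
  then show ?thesis
    using prod_pairs_swap[OF assms, of "\<lambda>a b. 1 + z b + z a * z b"] assms
    unfolding kern_def by (simp add: prod.remove[of _ "(j, Suc j)"] mult_ac)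
qed

lemma (in coeff_hom) ev_vand: "ev s (vand z S) = vand (\<lambda>i. ev s (z i)) S"
  by (simp add: vand_def ev_simps case_prod_unfold)

lemma (in coeff_hom) ev_kern: "ev s (kern z S) = kern (\<lambda>i. ev s (z i)) S"
  by (simp add: kern_def ev_simps case_prod_unfold)

lemma inj_Var: "inj (Var :: nat \<Rightarrow> 'a::comm_ring_1 mpoly)"
proof (rule injI)
  fix i j assume "Var i = (Var j :: 'a mpoly)"
  then have "Poly_Mapping.keys (Var i :: 'a mpoly) = Poly_Mapping.keys (Var j :: 'a mpoly)"
    by simp
  then have "Poly_Mapping.single i (1::nat) = Poly_Mapping.single j 1"
    by (simp add: Var_def)
  then have "Poly_Mapping.keys (Poly_Mapping.single i (1::nat)) =
      Poly_Mapping.keys (Poly_Mapping.single j (1::nat))"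
    by simp
  then show "i = j"
    by simp
qed

text \<open>The extra factor is the mirror image of the factor of \<open>kern\<close> for the pair
  \<open>(j, Suc j)\<close>, so its product with \<open>kern\<close> is symmetric under the swap,
  while \<open>vand\<close> changes sign. The whole product is antisymmetric, and a coefficient
  whose exponents at \<open>j\<close> and \<open>Suc j\<close> agree equals its own
  negative.\<close>

lemma lookup_swap_eq_0:
  fixes G :: "'a::{comm_ring_1, semiring_no_zero_divisors, semiring_char_0} mpoly"
  assumes S: "finite S" "j \<in> S" "Suc j \<in> S"
    and G: "subst (\<lambda>i. Var (swap j i)) G = G"
    and e: "Poly_Mapping.lookup e j = Poly_Mapping.lookup e (Suc j)"
  shows "Poly_Mapping.lookup
    (G * (1 + Var j + Var j * Var (Suc j)) * kern Var S * vand Var S) e = 0"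
proof -
  define H where "H = G * (1 + Var j + Var j * Var (Suc j)) * kern Var S * vand Var S"
  have "subst (\<lambda>i. Var (swap j i)) H = G *
      (kern (\<lambda>i. Var (swap j i)) S * (1 + Var (Suc j) + Var j * Var (Suc j))) *
      vand (\<lambda>i. Var (swap j i)) S"
    by (simp add: H_def subst.ev_simps subst.ev_kern subst.ev_vand G mult_ac)
  also have "\<dots> = - H"
    unfolding kern_swap[OF S] vand_swap[OF S] by (simp add: H_def mult_ac)
  finally have H: "subst (\<lambda>i. Var (swap j i)) H = - H" .
  have "bij_betw (swap j) (- {}) UNIV"
    by (rule bij_betwI[of _ _ _ "swap j"]) auto
  then have "Poly_Mapping.lookup (subst (\<lambda>i. if i \<in> {} then 0 else Var (swap j i)) H) e =
      Poly_Mapping.lookup H e"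
    by (rule lookup_subst_renaming) (use e in auto)
  then have "Poly_Mapping.lookup H e + Poly_Mapping.lookup H e = 0"
    by (simp add: H eq_neg_iff_add_eq_0)
  then have "2 * Poly_Mapping.lookup H e = 0"
    by (simp only: mult_2)
  then show ?thesis
    by (simp add: H_def)
qed

text \<open>Sets \<open>x_i\<close> to 0 and closes the gap in the numbering. The test
  \<open>j \<in> {i}\<close> matches the shape used in \<open>lookup_subst_renaming\<close>.\<close>

definition drop_var :: "nat \<Rightarrow> nat \<Rightarrow> 'a::comm_ring_1 mpoly" where
  "drop_var i j = (if j \<in> {i} then 0 else Var (if j < i then j else j - 1))"

text \<open>After \<open>vand_expand\<close>, the term with the \<open>N\<close>-th power of
  \<open>x_i\<close> contributes only if \<open>e\<close> reaches \<open>N\<close> at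
  \<open>i\<close>, that is for \<open>i\<close> up to \<open>Suc k\<close>. There the exponent is
  exactly \<open>N\<close>, so the cofactor is evaluated at \<open>x_i = 0\<close>. The vector
  \<open>e'\<close> arises from \<open>e\<close> by removing one of its equal entries
  \<open>N\<close>, and is therefore the same for every \<open>i\<close>.\<close>

lemma lookup_elimination:
  fixes F :: "'a::idom mpoly"
  assumes k: "k \<le> N"
    and e: "\<And>i. i \<in> {1..Suc k} \<Longrightarrow> Poly_Mapping.lookup e i = N"
    and e_less: "\<And>i. i \<in> {Suc k<..Suc N} \<Longrightarrow> Poly_Mapping.lookup e i < N"
    and e0: "Poly_Mapping.lookup e' 0 = Poly_Mapping.lookup e 0"
    and e': "\<And>i. i \<in> {1..k} \<Longrightarrow> Poly_Mapping.lookup e' i = N"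
    and e'_shift: "\<And>i. k < i \<Longrightarrow> Poly_Mapping.lookup e' i = Poly_Mapping.lookup e (Suc i)"
  shows "Poly_Mapping.lookup (F * kern Var {1..Suc N} * vand Var {1..Suc N}) e =
    (\<Sum>i\<in>{1..Suc k}. (- 1) ^ (i - 1) * Poly_Mapping.lookup
       (subst (drop_var i) F * (\<Prod>j\<in>{i..N}. 1 + Var j) * kern Var {1..N} * vand Var {1..N}) e')"
proof -
  let ?S = "{1..Suc N}"
  define G where "G i = F * kern Var ?S * vand Var (?S - {i})" for i
  have card: "card {a \<in> ?S. a < i} = i - 1" if "i \<in> ?S" for i
  proof -
    have "{a \<in> ?S. a < i} = {1..<i}"
      using that by auto
    then show ?thesis
      by simp
  qed
  have "vand Var ?S = (\<Sum>i\<in>?S. (- 1) ^ card {a\<in>?S. a < i} * (Var i :: 'a mpoly) ^ N *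
      vand Var (?S - {i}))"
    by (rule vand_expand) (simp_all add: inj_on_subset[OF inj_Var])
  also have "\<dots> = (\<Sum>i\<in>?S. (- 1) ^ (i - 1) * (Var i :: 'a mpoly) ^ N * vand Var (?S - {i}))"
    by (intro sum.cong refl) (simp only: card)
  finally have "F * kern Var ?S * vand Var ?S =
      (\<Sum>i\<in>?S. F * kern Var ?S * ((- 1) ^ (i - 1) * Var i ^ N * vand Var (?S - {i})))"
    by (simp only: sum_distrib_left)
  also have "\<dots> = (\<Sum>i\<in>?S. Const ((- 1) ^ (i - 1)) * (G i * Var i ^ N))"
    by (intro sum.cong refl) (simp add: G_def mult_ac Const_power Const_uminus)
  finally have "F * kern Var ?S * vand Var ?S =
      (\<Sum>i\<in>?S. Const ((- 1) ^ (i - 1)) * (G i * Var i ^ N))" .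
  then have "Poly_Mapping.lookup (F * kern Var ?S * vand Var ?S) e =
      (\<Sum>i\<in>?S. (- 1) ^ (i - 1) * Poly_Mapping.lookup (G i * Var i ^ N) e)"
    by (simp only: lookup_sum lookup_Const_mult)
  also have "\<dots> = (\<Sum>i\<in>{1..Suc k}. (- 1) ^ (i - 1) * Poly_Mapping.lookup (G i * Var i ^ N) e)"
    using k e_less by (intro sum.mono_neutral_right) (auto simp: lookup_mult_Var_power_eq_0)
  also have "\<dots> = (\<Sum>i\<in>{1..Suc k}. (- 1) ^ (i - 1) * Poly_Mapping.lookup
       (subst (drop_var i) F * (\<Prod>j\<in>{i..N}. 1 + Var j) * kern Var {1..N} * vand Var {1..N}) e')"
  proof (intro sum.cong refl arg_cong2[where f = "(*)"])
    fix i assume i: "i \<in> {1..Suc k}"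
    define d where "d j = (if j < i then j else j - 1)" for j
    \<comment> \<open>The exponent left after dividing by the power of \<open>x_i\<close>. It is 0
      at \<open>i\<close>, so only monomials free of \<open>x_i\<close> matter and
      \<open>x_i\<close> may be set to 0.\<close>
    define e1 where "e1 = e - Poly_Mapping.single i N"
    have e_e1: "e = e1 + Poly_Mapping.single i N"
      using e[OF i] by (intro poly_mapping_eqI)
          (auto simp: e1_def lookup_minus lookup_add lookup_single when_def)
    have "Poly_Mapping.lookup (G i * Var i ^ N) e = Poly_Mapping.lookup (G i) e1"
      unfolding Var_power by (subst e_e1) (rule lookup_monom_mult)
    also have "\<dots> = Poly_Mapping.lookup (subst (\<lambda>j. if j \<in> {i} then 0 else Var (d j)) (G i)) e'"
    proof (rule lookup_subst_renaming[symmetric])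
      show "bij_betw d (- {i}) UNIV"
        by (rule bij_betwI[of _ _ _ "\<lambda>j. if j < i then j else Suc j"]) (use i in \<open>auto simp: d_def\<close>)
      show "Poly_Mapping.lookup e1 j = 0" if "j \<in> {i}" for j
        using that e[OF i] by (simp add: e1_def lookup_minus)
      show "Poly_Mapping.lookup e1 j = Poly_Mapping.lookup e' (d j)" if "j \<notin> {i}" for j
      proof -
        have "Poly_Mapping.lookup e1 j = Poly_Mapping.lookup e j"
          using that by (simp add: e1_def lookup_minus lookup_single)
        moreover consider "j = 0" | "j < i" "j \<noteq> 0" | "i < j" "j \<le> Suc k" | "Suc k < j"
          using \<open>j \<notin> {i}\<close> by fastforce
        then have "Poly_Mapping.lookup e j = Poly_Mapping.lookup e' (d j)"
        proof cases
          case 1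
          then show ?thesis
            using e0 by (simp add: d_def)
        next
          case 2
          then have "d j = j" "j \<in> {1..k}" "j \<in> {1..Suc k}"
            using i by (auto simp: d_def)
          then show ?thesis
            by (simp only: e e')
        next
          case 3
          then have "d j \<in> {1..k}" "j \<in> {1..Suc k}"
            using i by (auto simp: d_def)
          then show ?thesis
            by (simp only: e e')
        next
          case 4
          then have "d j = j - 1" "k < j - 1" "Suc (j - 1) = j"
            using i by (auto simp: d_def)
          then show ?thesis
            by (simp only: e'_shift)
        qed
        ultimately show ?thesis
          by simp
      qed
    qed
    also have "(\<lambda>j. if j \<in> {i} then 0 else Var (d j)) = (drop_var i :: nat \<Rightarrow> 'a mpoly)"
      by (auto simp: drop_var_def d_def)
    also have "subst (drop_var i) (G i) =
        subst (drop_var i) F * (\<Prod>j\<in>{i..N}. 1 + Var j) * kern Var {1..N} * vand Var {1..N}"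
    proof -
      have mono: "strict_mono_on (?S - {i}) d"
        using i by (auto simp: strict_mono_on_def d_def)
      have img: "d ` (?S - {i}) = {1..N}"
      proof
        show "d ` (?S - {i}) \<subseteq> {1..N}"
          using i k by (auto simp: d_def)
        show "{1..N} \<subseteq> d ` (?S - {i})"
        proof
          fix j assume "j \<in> {1..N}"
          then have "d (if j < i then j else Suc j) = j" "(if j < i then j else Suc j) \<in> ?S - {i}"
            using i by (auto simp: d_def)
          then show "j \<in> d ` (?S - {i})"
            by (metis imageI)
        qed
      qed
      have drop: "drop_var i j = (Var (d j) :: 'a mpoly)" if "j \<noteq> i" for j
        using that by (simp add: drop_var_def d_def)
      have "vand (drop_var i) (?S - {i}) = (vand (\<lambda>j. Var (d j)) (?S - {i}) :: 'a mpoly)"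
        unfolding vand_def by (intro prod.cong refl) (auto simp: pairs_def drop)
      also have "\<dots> = vand Var {1..N}"
        unfolding vand_def using prod_pairs_strict_mono[OF mono, of
            "\<lambda>a b. Var a - (Var b :: 'a mpoly)"]
        by (simp only: img)
      finally have v: "vand (drop_var i) (?S - {i}) = (vand Var {1..N} :: 'a mpoly)" .
      \<comment> \<open>At \<open>x_i = 0\<close> the kernel factors of pairs \<open>(a, i)\<close>
        become 1, and those of pairs \<open>(i, b)\<close> become \<open>1 + x_b\<close>. After
        renumbering the latter form the product over \<open>{i..N}\<close>.\<close>
      have "kern (drop_var i) ?S = kern (drop_var i) (?S - {i}) *
          (\<Prod>b\<in>{b\<in>?S. i < b}. 1 + (drop_var i b :: 'a mpoly))"
        unfolding kern_def using i k
        by (subst prod_pairs_remove[of _ i]) (auto simp: drop_var_def)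
      also have "kern (drop_var i) (?S - {i}) = (kern (\<lambda>j. Var (d j)) (?S - {i}) :: 'a mpoly)"
        unfolding kern_def by (intro prod.cong refl) (auto simp: pairs_def drop)
      also have "\<dots> = kern Var {1..N}"
        unfolding kern_def using prod_pairs_strict_mono[OF mono, of
            "\<lambda>a b. 1 + Var b + Var a * (Var b :: 'a mpoly)"]
        by (simp only: img)
      also have "(\<Prod>b\<in>{b\<in>?S. i < b}. 1 + (drop_var i b :: 'a mpoly)) = (\<Prod>j\<in>{i..N}. 1 + Var j)"
        by (rule prod.reindex_bij_witness[of _ Suc "\<lambda>b. b - 1"])
          (use i in \<open>auto simp: drop_var_def\<close>)
      finally have k: "kern (drop_var i) ?S =
          kern Var {1..N} * (\<Prod>j\<in>{i..N}. 1 + (Var j :: 'a mpoly))" .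
      show ?thesis
        by (simp only: G_def subst.ev_mult subst.ev_vand subst.ev_kern subst.ev_Var v k mult_ac)
    qed
    finally show "Poly_Mapping.lookup (G i * Var i ^ N) e = Poly_Mapping.lookup
       (subst (drop_var i) F * (\<Prod>j\<in>{i..N}. 1 + Var j) * kern Var {1..N} * vand Var {1..N}) e'" .
  qed
  finally show ?thesis .
qed

subsection \<open>Interlacing rows\<close>

text \<open>A row of \<open>k\<close> entries is bounded by \<open>k + 1\<close> values of
  \<open>b\<close>. For a trapezoid the last of these is either the final bottom entry or the bound
  supplied by \<open>next_bounds\<close>. The value 0 outside \<open>{1..k}\<close> makes each row a
  unique function.\<close>

definition interlacing :: "(nat \<Rightarrow> nat) \<Rightarrow> nat \<Rightarrow> (nat \<Rightarrow> nat) set" where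
  "interlacing b k = {l. (\<forall>j\<in>{1..k}. b j \<le> l j \<and> l j \<le> b (Suc j)) \<and>
     strict_mono_on {1..k} l \<and> (\<forall>j. j \<notin> {1..k} \<longrightarrow> l j = 0)}"

lemma strict_mono_on_Suc_iff:
  "strict_mono_on {1..Suc k} (l :: nat \<Rightarrow> nat) \<longleftrightarrow>
    strict_mono_on {1..k} l \<and> (1 \<le> k \<longrightarrow> l k < l (Suc k))"
proof
  assume "strict_mono_on {1..k} l \<and> (1 \<le> k \<longrightarrow> l k < l (Suc k))"
  then have mono: "strict_mono_on {1..k} l" and last: "1 \<le> k \<Longrightarrow> l k < l (Suc k)"
    by auto
  show "strict_mono_on {1..Suc k} l"
  proof (rule strict_mono_onI)
    fix r s assume rs: "r \<in> {1..Suc k}" "s \<in> {1..Suc k}" "r < s"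
    show "l r < l s"
    proof (cases "s = Suc k")
      case True
      with rs have "l r \<le> l k"
        using strict_mono_on_leD[OF mono, of r k] by auto
      with last rs True show ?thesis
        by auto
    next
      case False
      with rs show ?thesis
        by (intro strict_mono_onD[OF mono]) auto
    qed
  qed
qed (auto simp: strict_mono_on_def)

lemma interlacing_0: "interlacing b 0 = {\<lambda>_. 0}"
  by (auto simp: interlacing_def strict_mono_on_def)

lemma finite_interlacing: "finite (interlacing b k)"
  by (rule finite_subset[OF _ finite_set_of_finite_funs[of "{1..k}" "{..\<Sum>j\<in>{1..k}. b (Suc j)}" 0]])
    (auto simp: interlacing_def intro!: order.trans[OF _ member_le_sum])

lemma interlacing_Suc_iff:
  "l \<in> interlacing b (Suc k) \<longleftrightarrow> l(Suc k := 0) \<in> interlacing b k \<and>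
    b (Suc k) \<le> l (Suc k) \<and> l (Suc k) \<le> b (Suc (Suc k)) \<and> (1 \<le> k \<longrightarrow> l k < l (Suc k))"
proof -
  have "strict_mono_on {1..k} (l(Suc k := 0)) = strict_mono_on {1..k} l"
    by (auto simp: strict_mono_on_def)
  moreover have "(\<forall>j\<in>{1..Suc k}. P j) \<longleftrightarrow> (\<forall>j\<in>{1..k}. P j) \<and> P (Suc k)" for P
    by (auto simp: atLeastAtMostSuc_conv)
  ultimately show ?thesis
    unfolding interlacing_def mem_Collect_eq strict_mono_on_Suc_iff by auto
qed

text \<open>A row is built by appending its last entry \<open>v\<close>. The guard
  \<open>1 \<le> k\<close> exempts the first entry, which has no left neighbour to exceed.\<close>

lemma sum_interlacing_Suc:
  "(\<Sum>l\<in>interlacing b (Suc k). f l) =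
    (\<Sum>l\<in>interlacing b k. \<Sum>v | v \<in> {b (Suc k)..b (Suc (Suc k))} \<and> (1 \<le> k \<longrightarrow> l k < v).
        f (l(Suc k := v)))"
proof -
  let ?V = "\<lambda>l. {v. v \<in> {b (Suc k)..b (Suc (Suc k))} \<and> (1 \<le> k \<longrightarrow> l k < v)}"
  have 0: "l (Suc k) = 0" if "l \<in> interlacing b k" for l
    using that by (simp add: interlacing_def)
  have "(\<Sum>l\<in>interlacing b (Suc k). f l) = (\<Sum>(l, v)\<in>Sigma (interlacing b k) ?V. f (l(Suc k := v)))"
  proof (rule sum.reindex_bij_witness[of _ "\<lambda>(l, v). l(Suc k := v)"
      "\<lambda>l. (l(Suc k := 0), l (Suc k))"])
    fix l assume "l \<in> interlacing b (Suc k)"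
    then show "(l(Suc k := 0), l (Suc k)) \<in> Sigma (interlacing b k) ?V"
      unfolding interlacing_Suc_iff by auto
  next
    fix p assume "p \<in> Sigma (interlacing b k) ?V"
    then obtain l v where p: "p = (l, v)" and l: "l \<in> interlacing b k" and v: "v \<in> ?V l"
      by blast
    have "(l(Suc k := v))(Suc k := 0) = l"
      using 0[OF l] by (simp add: fun_upd_idem)
    then show "(\<lambda>(l, v). l(Suc k := v)) p \<in> interlacing b (Suc k)"
      and "(\<lambda>l. (l(Suc k := 0), l (Suc k))) ((\<lambda>(l, v). l(Suc k := v)) p) = p"
      using l v unfolding p interlacing_Suc_iff by (simp_all del: fun_upd_upd)
  qed (auto simp: fun_upd_idem)
  then show ?thesis
    by (simp add: sum.Sigma finite_interlacing)
qed

section \<open>Weighted sums over interlacing rows\<close>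

definition row_sum :: "(nat \<Rightarrow> nat \<Rightarrow> 'r::comm_ring_1) \<Rightarrow> (nat \<Rightarrow> nat) \<Rightarrow> nat \<Rightarrow> 'r" where
  "row_sum w b k = (\<Sum>l\<in>interlacing b k. \<Prod>j\<in>{1..k}. w j (l j))"

lemma row_sum_0: "row_sum w b 0 = 1"
  by (simp add: row_sum_def interlacing_0)

lemma prod_upd_Suc:
  "(\<Prod>j\<in>{1..Suc k}. w j ((l(Suc k := v)) j)) =
      (\<Prod>j\<in>{1..k}. w j (l j)) * (w (Suc k) v :: 'r::comm_ring_1)"
proof -
  have "(\<Prod>j\<in>{1..k}. w j ((l(Suc k := v)) j)) = (\<Prod>j\<in>{1..k}. w j (l j))"
    by (intro prod.cong) auto
  then show ?thesis
    by simp
qed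

lemma row_sum_1: "row_sum w b (Suc 0) = (\<Sum>v\<in>{b 1..b 2}. w 1 v)"
proof -
  have "{v. x \<le> v \<and> v \<le> y} = {x..y}" for x y :: nat
    by auto
  then show ?thesis
    unfolding row_sum_def sum_interlacing_Suc interlacing_0 by (simp add: numeral_2_eq_2)
qed

text \<open>Without strictness the sum over the last entry factors off. A failure of strictness forces
  both entries to equal \<open>b (k + 2)\<close>, and then the next entry to the left is smaller anyway.\<close>

lemma row_sum_Suc_Suc:
  assumes b: "b (Suc k) < b (Suc (Suc k))" "b (Suc (Suc k)) \<le> b (Suc (Suc (Suc k)))"
  shows "row_sum w b (Suc (Suc k)) =
    row_sum w b (Suc k) * (\<Sum>v\<in>{b (Suc (Suc k))..b (Suc (Suc (Suc k)))}. w (Suc (Suc k)) v) -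
    row_sum w b k * (w (Suc k) (b (Suc (Suc k))) * w (Suc (Suc k)) (b (Suc (Suc k))))"
proof -
  define c where "c = b (Suc (Suc k))"
  define V where "V = {c..b (Suc (Suc (Suc k)))}"
  define W where "W = (\<Sum>v\<in>V. w (Suc (Suc k)) v)"
  define P where "P l = (\<Prod>j\<in>{1..Suc k}. w j (l j))" for l
  \<comment> \<open>Since the previous entry is at most \<open>c\<close> and \<open>v\<close> is at
    least \<open>c\<close>, strictness excludes at most the single value
    \<open>v = c\<close>.\<close>
  have inner: "(\<Sum>v | v \<in> V \<and> (1 \<le> Suc k \<longrightarrow> l (Suc k) < v). w (Suc (Suc k)) v) =
      W - (if l (Suc k) = c then w (Suc (Suc k)) c else 0)" if "l \<in> interlacing b (Suc k)" for l
  proof -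
    have le: "l (Suc k) \<le> c"
      using that by (simp add: interlacing_Suc_iff c_def)
    show ?thesis
    proof (cases "l (Suc k) = c")
      case True
      have "V = insert c {v. v \<in> V \<and> (1 \<le> Suc k \<longrightarrow> l (Suc k) < v)}"
        using True b by (auto simp: V_def c_def)
      moreover have "finite {v. v \<in> V \<and> (1 \<le> Suc k \<longrightarrow> l (Suc k) < v)}"
        by (simp add: V_def)
      ultimately have "W = w (Suc (Suc k)) c +
          (\<Sum>v | v \<in> V \<and> (1 \<le> Suc k \<longrightarrow> l (Suc k) < v). w (Suc (Suc k)) v)"
        unfolding W_def using True
        by (metis (no_types, lifting) mem_Collect_eq sum.insert order_less_irrefl le_add1
            plus_1_eq_Suc)
      then show ?thesis
        using True by simp
    next
      case False
      with le have "{v. v \<in> V \<and> (1 \<le> Suc k \<longrightarrow> l (Suc k) < v)} = V"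
        by (auto simp: V_def)
      with False show ?thesis
        by (simp add: W_def)
    qed
  qed
  have tie: "(\<Sum>l\<in>interlacing b (Suc k). P l * (if l (Suc k) = c then w (Suc (Suc k)) c else 0)) =
      row_sum w b k * (w (Suc k) c * w (Suc (Suc k)) c)"
  proof -
    have "(\<Sum>v | v \<in> {b (Suc k)..c} \<and> (1 \<le> k \<longrightarrow> l k < v).
        w (Suc k) v * (if v = c then w (Suc (Suc k)) c else 0)) = w (Suc k) c * w (Suc (Suc k)) c"
      if "l \<in> interlacing b k" for l
    proof -
      have "l k \<le> b (Suc k)" if "1 \<le> k"
        using \<open>l \<in> interlacing b k\<close> that by (auto simp: interlacing_def)
      then have "c \<in> {v. v \<in> {b (Suc k)..c} \<and> (1 \<le> k \<longrightarrow> l k < v)}"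
        using b by (auto simp: c_def)
      then show ?thesis
        by (subst sum.remove[of _ c]) (auto intro!: sum.neutral)
    qed
    then show ?thesis
      unfolding sum_interlacing_Suc P_def prod_upd_Suc row_sum_def sum_distrib_right
      by (intro sum.cong refl) (simp add: c_def mult.assoc flip: sum_distrib_left)
  qed
  have "row_sum w b (Suc (Suc k)) = (\<Sum>l\<in>interlacing b (Suc k).
      P l * (\<Sum>v | v \<in> V \<and> (1 \<le> Suc k \<longrightarrow> l (Suc k) < v). w (Suc (Suc k)) v))"
    unfolding row_sum_def sum_interlacing_Suc[of _ _ "Suc k"] prod_upd_Suc
    by (simp add: P_def V_def c_def flip: sum_distrib_left)
  also have "\<dots> = (\<Sum>l\<in>interlacing b (Suc k). P l *
      (W - (if l (Suc k) = c then w (Suc (Suc k)) c else 0)))"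
    using inner by (intro sum.cong) auto
  also have "\<dots> = row_sum w b (Suc k) * W - row_sum w b k * (w (Suc k) c * w (Suc (Suc k)) c)"
    by (simp only: right_diff_distrib sum_subtractf tie)
        (simp add: row_sum_def P_def sum_distrib_right)
  finally show ?thesis
    by (simp add: W_def V_def c_def)
qed

text \<open>The hypothesis \<open>kill\<close> lets the functional \<open>L\<close> trade \<open>r j\<close> for \<open>- u j * d (j + 1)\<close>, after
  which the recursion telescopes to an alternating sum.\<close>

lemma alternating_expansion:
  fixes L :: "'m::comm_ring_1 \<Rightarrow> 'a::comm_ring_1" and T u d r :: "nat \<Rightarrow> 'm"
  assumes add: "\<And>x y. L (x + y) = L x + L y"
    and T0: "T 0 = p" and T1: "T (Suc 0) = p * u 1 - d 1"
    and T_rec: "\<And>j. Suc (Suc j) \<le> k \<Longrightarrow>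
      T (Suc (Suc j)) = T (Suc j) * (u (Suc (Suc j)) - d (Suc (Suc j))) - T j * r (Suc j)"
    and kill: "\<And>i j. Suc (Suc j) \<le> i \<Longrightarrow> i \<le> k \<Longrightarrow>
      L (T j * (u (Suc j) * d (Suc (Suc j)) + r (Suc j)) * (\<Prod>a\<in>{Suc (Suc (Suc j))..i}. d a) *
          (\<Prod>a\<in>{Suc i..k}. u a)) = 0"
    and k: "1 \<le> k"
  shows "L (T k) = L (p * (\<Prod>a\<in>{1..k}. u a)) +
    (\<Sum>i\<in>{1..k}. (- 1) ^ i * L ((\<Prod>a\<in>{1..i}. d a) * (\<Prod>a\<in>{Suc i..k}. u a)))"
proof -
  have diff: "L (x - y) = L x - L y" for x y
    using add[of "x - y" y] by (simp add: algebra_simps)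
  \<comment> \<open>\<open>W j\<close> is the amount by which \<open>T (Suc j)\<close> falls short
    of \<open>T j * u (Suc j)\<close>. The value at 0 encodes the initial condition on
    \<open>T (Suc 0)\<close>.\<close>
  define W where "W j = (case j of 0 \<Rightarrow> d 1 | Suc j' \<Rightarrow> T j * d (Suc j) + T j' * r j)" for j
  have T_W: "T (Suc j) = T j * u (Suc j) - W j" if "Suc j \<le> k" for j
    using that T0 T1 T_rec by (cases j) (simp_all add: W_def algebra_simps)
  \<comment> \<open>Under \<open>L\<close>, \<open>kill\<close> replaces \<open>W (Suc j)\<close> by
    \<open>- W j * d (Suc (Suc j))\<close>, as long as only further factors \<open>d\<close> and
    then \<open>u\<close> follow. Iterating down to \<open>W 0 = d 1\<close> gives the sign and the
    full product of the \<open>d a\<close>.\<close>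
  have W: "L (W j * (\<Prod>a\<in>{Suc (Suc j)..i}. d a) * (\<Prod>a\<in>{Suc i..k}. u a)) =
      (- 1) ^ j * L ((\<Prod>a\<in>{1..i}. d a) * (\<Prod>a\<in>{Suc i..k}. u a))" if "Suc j \<le> i" "i \<le> k" for i j
    using that
  proof (induction j)
    case 0
    then have "(\<Prod>a\<in>{1..i}. d a) = d 1 * (\<Prod>a\<in>{Suc (Suc 0)..i}. d a)"
      by (simp add: prod.atLeast_Suc_atMost)
    then show ?case
      by (simp add: W_def)
  next
    case (Suc j)
    let ?d = "\<Prod>a\<in>{Suc (Suc (Suc j))..i}. d a" and ?u = "\<Prod>a\<in>{Suc i..k}. u a"
    have d: "(\<Prod>a\<in>{Suc (Suc j)..i}. d a) = d (Suc (Suc j)) * ?d"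
      using Suc.prems by (simp add: prod.atLeast_Suc_atMost)
    have W_eq: "W (Suc j) = T j * (u (Suc j) * d (Suc (Suc j)) + r (Suc j)) - W j * d (Suc (Suc j))"
      using Suc.prems by (simp add: W_def[of "Suc j"] T_W algebra_simps)
    have "W (Suc j) * ?d * ?u = T j * (u (Suc j) * d (Suc (Suc j)) + r (Suc j)) * ?d * ?u
        - W j * (\<Prod>a\<in>{Suc (Suc j)..i}. d a) * ?u"
      by (simp only: d W_eq) (simp add: algebra_simps)
    then have "L (W (Suc j) * ?d * ?u) = - L (W j * (\<Prod>a\<in>{Suc (Suc j)..i}. d a) * ?u)"
      using kill[of j i] Suc.prems by (simp only: diff) simp
    with Suc show ?case
      by simp
  qed
  \<comment> \<open>Telescoping: with the missing columns filled up by \<open>u\<close>, passing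
    from \<open>j\<close> to \<open>Suc j\<close> adds exactly one term of the alternating
    sum.\<close>
  have "L (T j * (\<Prod>a\<in>{Suc j..k}. u a)) = L (p * (\<Prod>a\<in>{1..k}. u a)) +
    (\<Sum>i\<in>{1..j}. (- 1) ^ i * L ((\<Prod>a\<in>{1..i}. d a) * (\<Prod>a\<in>{Suc i..k}. u a)))" if "j \<le> k" for j
    using that
  proof (induction j)
    case 0
    then show ?case
      by (simp add: T0)
  next
    case (Suc j)
    have "T (Suc j) * (\<Prod>a\<in>{Suc (Suc j)..k}. u a) =
        T j * (\<Prod>a\<in>{Suc j..k}. u a) - W j * (\<Prod>a\<in>{Suc (Suc j)..Suc j}. d a) *
            (\<Prod>a\<in>{Suc (Suc j)..k}. u a)"
      using Suc.prems by (simp add: prod.atLeast_Suc_atMost[of "Suc j"] T_W algebra_simps)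
    then show ?case
      using Suc W[of j "Suc j"] by (simp only: diff) simp
  qed
  from this[of k] show ?thesis
    by simp
qed

subsection \<open>Recursion for the constant term\<close>

text \<open>Expresses that \<open>f\<close> is a polynomial in \<open>x_j\<close> alone, in the form
  in which it is used: no substitution that fixes \<open>x_j\<close> changes
  \<open>f\<close>.\<close>

definition only_var :: "nat \<Rightarrow> 'a::comm_ring_1 mpoly \<Rightarrow> bool" where
  "only_var j f \<longleftrightarrow> (\<forall>s. s j = Var j \<longrightarrow> subst s f = f)"

lemma only_varD: "only_var j f \<Longrightarrow> s j = Var j \<Longrightarrow> subst s f = f"
  by (simp add: only_var_def)

lemma subst_prod_only_var:
  assumes "\<And>j. j \<in> A \<Longrightarrow> only_var j (f j)" "\<And>j. j \<in> A \<Longrightarrow> s j = Var j"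
  shows "subst s (\<Prod>j\<in>A. f j) = (\<Prod>j\<in>A. f j)"
  unfolding subst.ev_prod by (intro prod.cong refl only_varD) (use assms in auto)

text \<open>One shape covers both kinds of columns: those with a prescribed bottom entry take
  \<open>q j = 0\<close>, and those to the right of column \<open>k\<close> take
  \<open>q j = Q\<close> with exponent \<open>m + k\<close>.\<close>

definition column_factor :: "(nat \<Rightarrow> 'a::comm_ring_1) \<Rightarrow> (nat \<Rightarrow> nat) \<Rightarrow> nat \<Rightarrow> 'a mpoly" where
  "column_factor q c j = (1 + Const (q j) * Var j) * (1 + Var j) ^ c j"

text \<open>The factor of column \<open>Suc j\<close> after a variable to its left is deleted: it is
  renumbered to \<open>j\<close> and absorbs the factor \<open>1 + x_j\<close> left over from the
  kernel.\<close>

definition shifted_factor :: "(nat \<Rightarrow> 'a::comm_ring_1) \<Rightarrow> (nat \<Rightarrow> nat) \<Rightarrow> nat \<Rightarrow> 'a mpoly" where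
  "shifted_factor q c j = (1 + Const (q (Suc j)) * Var j) * (1 + Var j) ^ Suc (c (Suc j))"

lemma only_var_column_factor: "only_var j (column_factor q c j)"
  by (simp add: only_var_def column_factor_def subst.ev_simps)

lemma only_var_shifted_factor: "only_var j (shifted_factor q c j)"
  by (simp add: only_var_def shifted_factor_def subst.ev_simps)

text \<open>Columns before \<open>i\<close> are unchanged, column \<open>i\<close> is evaluated at 0
  and becomes 1, and the later ones move down by one place and absorb the factors
  \<open>1 + x_j\<close>.\<close>

lemma subst_drop_var_columns:
  fixes q :: "nat \<Rightarrow> 'a::comm_ring_1"
  assumes "1 \<le> i" "i \<le> Suc N"
  shows "subst (drop_var i) (\<Prod>j\<in>{2..Suc N}. column_factor q c j) * (\<Prod>j\<in>{i..N}. 1 + Var j) =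
    (\<Prod>j\<in>{2..<i}. column_factor q c j) * (\<Prod>j\<in>{i..N}. shifted_factor q c j)"
proof -
  let ?f = "\<lambda>j. subst (drop_var i) (column_factor q c j)"
  \<comment> \<open>The middle set is empty for \<open>i = 1\<close>, because column 1 is treated
    separately.\<close>
  have "{2..Suc N} = {2..<i} \<union> ({i} \<inter> {2..}) \<union> {Suc i..Suc N}"
    using assms by auto
  then have "prod ?f {2..Suc N} = prod ?f ({2..<i} \<union> ({i} \<inter> {2..}) \<union> {Suc i..Suc N})"
    by (rule arg_cong)
  also have "\<dots> = prod ?f {2..<i} * prod ?f ({i} \<inter> {2..}) * prod ?f {Suc i..Suc N}"
    by (subst prod.union_disjoint; (subst prod.union_disjoint)?) auto
  also have "prod ?f ({i} \<inter> {2..}) = 1"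
    by (rule prod.neutral) (simp add: column_factor_def drop_var_def subst.ev_simps)
  also have "prod ?f {2..<i} = (\<Prod>j\<in>{2..<i}. column_factor q c j)"
    by (intro prod.cong refl only_varD[OF only_var_column_factor]) (simp add: drop_var_def)
  finally have split: "prod ?f {2..Suc N} =
      (\<Prod>j\<in>{2..<i}. column_factor q c j) * prod ?f {Suc i..Suc N}"
    by simp
  have tail: "prod ?f {Suc i..Suc N} * (\<Prod>j\<in>{i..N}. 1 + Var j) = (\<Prod>j\<in>{i..N}. shifted_factor q c j)"
  proof -
    have "prod ?f {Suc i..Suc N} = (\<Prod>j\<in>{i..N}. ?f (Suc j))"
      by (rule prod.shift_bounds_cl_Suc_ivl)
    then show ?thesis
      by (simp add: prod.distrib[symmetric] column_factor_def shifted_factor_def drop_var_def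
          subst.ev_simps mult_ac)
  qed
  show ?thesis
    by (simp only: subst.ev_prod split mult.assoc tail)
qed

lemma subst_row_sum:
  assumes "\<And>j v. j \<in> {1..k} \<Longrightarrow> only_var j (w j v)" "\<And>j. j \<in> {1..k} \<Longrightarrow> s j = Var j"
  shows "subst s (row_sum w b k) = row_sum w b k"
  unfolding row_sum_def subst.ev_sum
  by (intro sum.cong refl subst_prod_only_var) (use assms in auto)

text \<open>\<open>lookup_elimination\<close> turns the left side, and
  \<open>alternating_expansion\<close> the right side, into the same alternating sum. In it the
  columns before the eliminated one keep their factor \<open>d\<close> and the others carry the
  shifted factor \<open>u\<close>. The first factor \<open>f\<close> may differ from the ideal one
  by a multiple of the \<open>R\<close>-th power of \<open>x_1\<close>, which is invisible since
  \<open>x_1\<close> has exponent \<open>N < R\<close> in \<open>e'\<close>.\<close>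

lemma constant_term_recursion:
  fixes f :: "'a::{idom, ring_char_0} mpoly" and w :: "nat \<Rightarrow> nat \<Rightarrow> 'a mpoly"
  assumes k: "1 \<le> k" "k \<le> N"
    and e: "\<And>i. i \<in> {1..Suc k} \<Longrightarrow> Poly_Mapping.lookup e i = N"
    and e_less: "\<And>i. i \<in> {Suc k<..Suc N} \<Longrightarrow> Poly_Mapping.lookup e i < N"
    and e0: "Poly_Mapping.lookup e' 0 = Poly_Mapping.lookup e 0"
    and e': "\<And>i. i \<in> {1..k} \<Longrightarrow> Poly_Mapping.lookup e' i = N"
    and e'_shift: "\<And>i. k < i \<Longrightarrow> Poly_Mapping.lookup e' i = Poly_Mapping.lookup e (Suc i)"
    and f: "only_var 1 f"
    and f_0: "\<And>s. s 1 = 0 \<Longrightarrow> subst s f = Const p"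
    and w: "\<And>j v. only_var j (w j v)"
    and w_upper: "\<And>j. 1 \<le> j \<Longrightarrow> j < k \<Longrightarrow> w j (c (Suc j)) = Var j * (1 + Var j) ^ c (Suc j)"
    and w_lower: "\<And>j. 2 \<le> j \<Longrightarrow> j \<le> k \<Longrightarrow> w j (c j) = Var j * (1 + Var j) ^ c j"
    and b: "\<And>j. 1 \<le> j \<Longrightarrow> j \<le> k \<Longrightarrow> b j = c j"
    and b_less: "\<And>j. 1 \<le> j \<Longrightarrow> j < k \<Longrightarrow> b j < b (Suc j)" and b_last: "b k \<le> b (Suc k)"
    and q: "\<And>j. 2 \<le> j \<Longrightarrow> j \<le> k \<Longrightarrow> q j = 0"
    and sum_1: "Const p * (\<Sum>v\<in>{b 1..b 2}. w 1 v) =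
        Const p * shifted_factor q c 1 - (f - g * Var 1 ^ R)"
    and sum_w: "\<And>j. 2 \<le> j \<Longrightarrow> j \<le> k \<Longrightarrow>
      (\<Sum>v\<in>{b j..b (Suc j)}. w j v) = shifted_factor q c j - column_factor q c j"
    and R: "N < R"
  shows "Poly_Mapping.lookup (f * (\<Prod>j\<in>{2..Suc N}. column_factor q c j) *
      kern Var {1..Suc N} * vand Var {1..Suc N}) e =
    Poly_Mapping.lookup (Const p * row_sum w b k * (\<Prod>j\<in>{Suc k..N}. shifted_factor q c j) *
      kern Var {1..N} * vand Var {1..N}) e'"
proof -
  define Y where "Y = (\<Prod>j\<in>{Suc k..N}. shifted_factor q c j)"
  define L where "L G = Poly_Mapping.lookup (G * Y * kern Var {1..N} * vand Var {1..N}) e'" for G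
  define u where "u = shifted_factor q c"
  \<comment> \<open>Subtracting the error term in column 1 makes the initial condition on
    \<open>T (Suc 0)\<close> exact. \<open>L_err\<close> discards the error again when the two sums
    are compared.\<close>
  define d where "d j = (if j = 1 then f - g * Var 1 ^ R else column_factor q c j)" for j
  define T where "T j = Const p * row_sum w b j" for j
  define r where "r j = w j (b (Suc j)) * w (Suc j) (b (Suc j))" for j
  have d_eq: "d j = (1 + Var j) ^ c j" if "2 \<le> j" "j \<le> k" for j
    using that q by (simp add: d_def column_factor_def)
  have u_eq: "u j = (1 + Var j) ^ Suc (c (Suc j))" if "1 \<le> j" "j < k" for j
    using that q by (simp add: u_def shifted_factor_def)
  have L_add: "L (x + y) = L x + L y" for x y
    by (simp add: L_def distrib_right lookup_add)
  have L_diff: "L (x - y) = L x - L y" for x y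
    by (simp add: L_def left_diff_distrib lookup_minus)
  have L_err: "L (g * Var 1 ^ R * G) = 0" for G
  proof -
    have "L (g * Var 1 ^ R * G) =
        Poly_Mapping.lookup (g * G * Y * kern Var {1..N} * vand Var {1..N} * Var 1 ^ R) e'"
      by (simp add: L_def mult_ac)
    also have "\<dots> = 0"
      using e'[of 1] k R by (intro lookup_mult_Var_power_eq_0) simp
    finally show ?thesis .
  qed
  have "L (T k) = L (Const p * (\<Prod>a\<in>{1..k}. u a)) +
    (\<Sum>i\<in>{1..k}. (- 1) ^ i * L ((\<Prod>a\<in>{1..i}. d a) * (\<Prod>a\<in>{Suc i..k}. u a)))"
  proof (rule alternating_expansion)
    show "T 0 = Const p"
      by (simp add: T_def row_sum_0)
    show "T (Suc 0) = Const p * u 1 - d 1"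
      using sum_1 by (simp add: T_def row_sum_1 u_def d_def)
    show "T (Suc (Suc j)) = T (Suc j) * (u (Suc (Suc j)) - d (Suc (Suc j))) - T j * r (Suc j)"
      if "Suc (Suc j) \<le> k" for j
    proof -
      have "b (Suc (Suc j)) \<le> b (Suc (Suc (Suc j)))"
        using that b_less[of "Suc (Suc j)"] b_last by (cases "Suc (Suc j) = k") auto
      then have "row_sum w b (Suc (Suc j)) =
          row_sum w b (Suc j) * (u (Suc (Suc j)) - d (Suc (Suc j)))
          - row_sum w b j * r (Suc j)"
        using that b_less[of "Suc j"] sum_w[of "Suc (Suc j)"]
        by (simp add: row_sum_Suc_Suc u_def d_def r_def)
      then show ?thesis
        by (simp only: T_def right_diff_distrib mult.assoc)
    qed
    show "L (T j * (u (Suc j) * d (Suc (Suc j)) + r (Suc j)) *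
        (\<Prod>a\<in>{Suc (Suc (Suc j))..i}. d a) * (\<Prod>a\<in>{Suc i..k}. u a)) = 0"
      if i: "Suc (Suc j) \<le> i" "i \<le> k" for i j
    proof -
      define z where "z = c (Suc (Suc j))"
      define G where "G = T j * ((1 + Var (Suc j)) ^ z * (1 + Var (Suc (Suc j))) ^ z) *
        (\<Prod>a\<in>{Suc (Suc (Suc j))..i}. d a) * (\<Prod>a\<in>{Suc i..k}. u a) * Y"
      have "r (Suc j) = (Var (Suc j) * (1 + Var (Suc j)) ^ z) *
          (Var (Suc (Suc j)) * (1 + Var (Suc (Suc j))) ^ z)"
        using i w_upper[of "Suc j"] w_lower[of "Suc (Suc j)"] b[of "Suc (Suc j)"]
        by (simp add: r_def z_def)
      \<comment> \<open>Writing \<open>x\<close> and \<open>y\<close> for the two adjacent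
        variables, the product \<open>u d\<close> contributes \<open>1 + x\<close> and the tie term
        \<open>r\<close> contributes \<open>x y\<close>. Together they give the factor that forces
        antisymmetry.\<close>
      then have "u (Suc j) * d (Suc (Suc j)) + r (Suc j) =
          ((1 + Var (Suc j)) ^ z * (1 + Var (Suc (Suc j))) ^ z) *
          (1 + Var (Suc j) + Var (Suc j) * Var (Suc (Suc j)))"
        using i u_eq[of "Suc j"] d_eq[of "Suc (Suc j)"] by (simp add: z_def algebra_simps)
      then have "L (T j * (u (Suc j) * d (Suc (Suc j)) + r (Suc j)) *
          (\<Prod>a\<in>{Suc (Suc (Suc j))..i}. d a) * (\<Prod>a\<in>{Suc i..k}. u a)) =
        Poly_Mapping.lookup (G * (1 + Var (Suc j) + Var (Suc j) * Var (Suc (Suc j))) *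
          kern Var {1..N} * vand Var {1..N}) e'"
        by (simp only: L_def G_def) (simp only: mult_ac)
      also have "\<dots> = 0"
      proof (rule lookup_swap_eq_0)
        let ?s = "\<lambda>a. Var (swap (Suc j) a) :: 'a mpoly"
        have s: "?s a = Var a" if "a \<noteq> Suc j" "a \<noteq> Suc (Suc j)" for a
          using that by simp
        \<comment> \<open>\<open>T j\<close> involves only columns up to \<open>j\<close> and the
          remaining factors only columns from \<open>j + 3\<close> on, so the swap fixes all of
          them.\<close>
        have "subst ?s (T j) = T j"
          unfolding T_def subst.ev_mult
          by (subst subst_row_sum) (use w s in auto)
        moreover have "subst ?s (\<Prod>a\<in>{Suc (Suc (Suc j))..i}. d a) = (\<Prod>a\<in>{Suc (Suc (Suc j))..i}. d a)"
          by (rule subst_prod_only_var) (use s in \<open>auto simp: d_def only_var_column_factor\<close>)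
        moreover have "subst ?s (\<Prod>a\<in>{Suc i..k}. u a) = (\<Prod>a\<in>{Suc i..k}. u a)"
          by (rule subst_prod_only_var) (use s i in \<open>auto simp: u_def only_var_shifted_factor\<close>)
        moreover have "subst ?s Y = Y"
          unfolding Y_def
          by (rule subst_prod_only_var) (use s i in \<open>auto simp: only_var_shifted_factor\<close>)
        ultimately show "subst ?s G = G"
          unfolding G_def by (simp add: subst.ev_mult subst.ev_power subst.ev_add mult_ac)
        show "Poly_Mapping.lookup e' (Suc j) = Poly_Mapping.lookup e' (Suc (Suc j))"
          using i by (simp add: e')
      qed (use i k in auto)
      finally show ?thesis .
    qed
  qed (use k L_add in auto)
  \<comment> \<open>The sums are matched term by term: eliminating \<open>x_1\<close> evaluates
    \<open>f\<close> to \<open>p\<close> and shifts every other column, while eliminating variable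
    \<open>Suc i\<close> leaves columns 1 to \<open>i\<close> unshifted.\<close>
  also have "\<dots> = (\<Sum>i\<in>{1..Suc k}. (- 1) ^ (i - 1) * Poly_Mapping.lookup
      (subst (drop_var i) (f * (\<Prod>j\<in>{2..Suc N}. column_factor q c j)) *
        (\<Prod>j\<in>{i..N}. 1 + Var j) * kern Var {1..N} * vand Var {1..N}) e')"
  proof -
    have split: "(\<Prod>j\<in>{i..N}. shifted_factor q c j) = (\<Prod>a\<in>{i..k}. u a) * Y" if "i \<in> {1..Suc k}" for i
    proof -
      have "{i..N} = {i..k} \<union> {Suc k..N}"
        using that k by auto
      then show ?thesis
        by (simp add: prod.union_disjoint u_def Y_def)
    qed
    have first: "Poly_Mapping.lookup
        (subst (drop_var 1) (f * (\<Prod>j\<in>{2..Suc N}. column_factor q c j)) *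
          (\<Prod>j\<in>{1..N}. 1 + Var j) * kern Var {1..N} * vand Var {1..N}) e' =
        L (Const p * (\<Prod>a\<in>{1..k}. u a))"
    proof -
      have "subst (drop_var 1) f = Const p"
        by (rule f_0) (simp add: drop_var_def)
      moreover have "subst (drop_var 1) (\<Prod>j\<in>{2..Suc N}. column_factor q c j) *
          (\<Prod>j\<in>{1..N}. 1 + Var j) =
          (\<Prod>a\<in>{1..k}. u a) * Y"
        using subst_drop_var_columns[of 1 N q c] split[of 1] by simp
      ultimately have "subst (drop_var 1) (f * (\<Prod>j\<in>{2..Suc N}. column_factor q c j)) *
          (\<Prod>j\<in>{1..N}. 1 + Var j) = Const p * (\<Prod>a\<in>{1..k}. u a) * Y"
        by (simp only: subst.ev_mult mult.assoc)
      then show ?thesis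
        by (simp only: L_def)
    qed
    have later: "Poly_Mapping.lookup
        (subst (drop_var (Suc i)) (f * (\<Prod>j\<in>{2..Suc N}. column_factor q c j)) *
          (\<Prod>j\<in>{Suc i..N}. 1 + Var j) * kern Var {1..N} * vand Var {1..N}) e' =
        L ((\<Prod>a\<in>{1..i}. d a) * (\<Prod>a\<in>{Suc i..k}. u a))" if i: "i \<in> {1..k}" for i
    proof -
      let ?D = "\<Prod>a\<in>{2..<Suc i}. column_factor q c a" and ?U = "\<Prod>a\<in>{Suc i..k}. u a"
      have "subst (drop_var (Suc i)) f = f"
        using f i by (intro only_varD) (auto simp: drop_var_def)
      moreover have "subst (drop_var (Suc i)) (\<Prod>j\<in>{2..Suc N}. column_factor q c j) *
          (\<Prod>j\<in>{Suc i..N}. 1 + Var j) =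
          ?D * (?U * Y)"
        using subst_drop_var_columns[of "Suc i" N q c] split[of "Suc i"] i k by simp
      ultimately have "subst (drop_var (Suc i)) (f * (\<Prod>j\<in>{2..Suc N}. column_factor q c j)) *
          (\<Prod>j\<in>{Suc i..N}. 1 + Var j) = f * ?D * ?U * Y"
        by (simp only: subst.ev_mult mult.assoc)
      moreover have "{1..i} = insert 1 {2..<Suc i}"
        using i by auto
      then have "(\<Prod>a\<in>{1..i}. d a) = (f - g * Var 1 ^ R) * ?D"
        by (simp add: d_def)
      then have "L ((\<Prod>a\<in>{1..i}. d a) * ?U) = L (f * ?D * ?U) - L (g * Var 1 ^ R * (?D * ?U))"
        by (simp only: left_diff_distrib mult.assoc L_diff)
      ultimately show ?thesis
        by (simp only: L_err) (simp add: L_def)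
    qed
    have "(\<Sum>i\<in>{1..Suc k}. h i) = h 1 + (\<Sum>i\<in>{1..k}. h (Suc i))" for h :: "nat \<Rightarrow> 'a"
    proof -
      have "(\<Sum>i\<in>{1..Suc k}. h i) = h 1 + (\<Sum>i\<in>{Suc 1..Suc k}. h i)"
        by (rule sum.atLeast_Suc_atMost) simp
      then show ?thesis
        by (simp only: sum.shift_bounds_cl_Suc_ivl)
    qed
    note split_sum = this
    show ?thesis
      unfolding split_sum first diff_self_eq_0 power_0 mult_1_left diff_Suc_1
      by (intro arg_cong2[where f = "(+)"] refl sum.cong arg_cong2[where f = "(*)"])
          (simp only: later)
  qed
  also have "\<dots> = Poly_Mapping.lookup (f * (\<Prod>j\<in>{2..Suc N}. column_factor q c j) *
      kern Var {1..Suc N} * vand Var {1..Suc N}) e"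
    by (rule lookup_elimination[symmetric]) (use k e e_less e0 e' e'_shift in auto)
  finally show ?thesis
    by (simp add: L_def T_def Y_def)
qed

subsection \<open>Removing the bottom row of a trapezoid\<close>

text \<open>Conditions internal to row \<open>i\<close>. \<open>M\<close> stands for
  \<open>m + n\<close>, which stays fixed when the bottom row is removed and \<open>m\<close> grows
  by 1.\<close>

definition gog_row :: "nat \<Rightarrow> nat \<Rightarrow> nat \<Rightarrow> (nat \<Rightarrow> nat) \<Rightarrow> bool" where
  "gog_row M k i r \<longleftrightarrow> (\<forall>j. j \<notin> {1..min i k} \<longrightarrow> r j = 0) \<and>
     (\<forall>j\<in>{1..min i k}. 0 < r j \<and> r j \<le> M - i + j \<and> (Suc j \<le> min i k \<longrightarrow> r j < r (Suc j)))"

text \<open>Conditions between row \<open>i\<close> and the next row \<open>r'\<close>. The upper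
  bound requires \<open>Suc j \<le> k\<close>, since the \<open>k\<close>-th diagonal has no
  neighbour to its lower right.\<close>

definition gog_adjacent :: "nat \<Rightarrow> nat \<Rightarrow> (nat \<Rightarrow> nat) \<Rightarrow> (nat \<Rightarrow> nat) \<Rightarrow> bool" where
  "gog_adjacent k i r r' \<longleftrightarrow>
     (\<forall>j\<in>{1..min i k}. r' j \<le> r j \<and> (Suc j \<le> k \<longrightarrow> r j \<le> r' (Suc j)))"

lemma gog_trapezoid_rows:
  "gog_trapezoid m n k a \<longleftrightarrow> (\<forall>i. i \<notin> {1..n} \<longrightarrow> a i = (\<lambda>_. 0)) \<and>
     (\<forall>i\<in>{1..n}. gog_row (m + n) k i (a i)) \<and>
     (\<forall>i\<in>{1..<n}. gog_adjacent k i (a i) (a (Suc i)))"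
  (is "?L \<longleftrightarrow> ?R")
proof
  assume ?L
  then show ?R
    unfolding gog_trapezoid_def gog_positions_def gog_row_def gog_adjacent_def fun_eq_iff
    by (auto simp: Ball_def)
next
  assume ?R
  then show ?L
    unfolding gog_trapezoid_def gog_positions_def gog_row_def gog_adjacent_def fun_eq_iff
    by (auto simp: Ball_def)
qed

text \<open>Raising \<open>m\<close> by 1 compensates for the lost row, so the bounds on the
  SE-diagonals are unchanged. The width becomes \<open>min k N\<close>, because row \<open>N\<close>
  has no more than \<open>N\<close> entries.\<close>

lemma gog_trapezoid_Suc:
  assumes "k \<le> Suc N"
  shows "gog_trapezoid m (Suc N) k a \<longleftrightarrow>
    gog_trapezoid (Suc m) N (min k N) (a(Suc N := (\<lambda>_. 0))) \<and>
    gog_row (m + Suc N) k (Suc N) (a (Suc N)) \<and>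
    (\<forall>j\<in>{1..min k N}. a (Suc N) j \<le> a N j \<and> (Suc j \<le> k \<longrightarrow> a N j \<le> a (Suc N) (Suc j)))"
proof -
  let ?a = "a(Suc N := (\<lambda>_. 0))"
  have row: "gog_row (m + Suc N) k i r = gog_row (Suc m + N) (min k N) i r" if "i \<in> {1..N}" for i r
  proof -
    have "min i (min k N) = min i k" "m + Suc N - i = Suc m + N - i"
      using that by auto
    then show ?thesis
      by (simp only: gog_row_def)
  qed
  have adj: "gog_adjacent k i r r' = gog_adjacent (min k N) i r r'" if "i \<in> {1..<N}" for i r r'
  proof -
    have "min i (min k N) = min i k" "j \<in> {1..min i k} \<Longrightarrow> Suc j \<le> min k N \<longleftrightarrow> Suc j \<le> k" for j
      using that by auto
    then show ?thesis
      by (simp add: gog_adjacent_def)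
  qed
  have "(\<forall>i. i \<notin> {1..Suc N} \<longrightarrow> a i = (\<lambda>_. 0)) \<longleftrightarrow> (\<forall>i. i \<notin> {1..N} \<longrightarrow> ?a i = (\<lambda>_. 0))"
    by (auto simp: le_Suc_eq)
  moreover have "(\<forall>i\<in>{1..Suc N}. gog_row (m + Suc N) k i (a i)) \<longleftrightarrow>
      (\<forall>i\<in>{1..N}. gog_row (Suc m + N) (min k N) i (?a i)) \<and>
      gog_row (m + Suc N) k (Suc N) (a (Suc N))"
    using row by (auto simp: atLeastAtMostSuc_conv)
  moreover have "(\<forall>i\<in>{1..<Suc N}. gog_adjacent k i (a i) (a (Suc i))) \<longleftrightarrow>
      (\<forall>i\<in>{1..<N}. gog_adjacent (min k N) i (?a i) (?a (Suc i))) \<and>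
          (1 \<le> N \<longrightarrow> gog_adjacent k N (a N) (a (Suc N)))"
  proof -
    have "{1..<Suc N} = {1..<N} \<union> (if 1 \<le> N then {N} else {})"
      by auto
    then show ?thesis
      using adj by auto
  qed
  moreover have "(1 \<le> N \<longrightarrow> gog_adjacent k N (a N) (a (Suc N))) \<longleftrightarrow>
      (\<forall>j\<in>{1..min k N}. a (Suc N) j \<le> a N j \<and> (Suc j \<le> k \<longrightarrow> a N j \<le> a (Suc N) (Suc j)))"
    by (auto simp: gog_adjacent_def)
  ultimately show ?thesis
    unfolding gog_trapezoid_rows by blast
qed

lemma strict_mono_on_atLeastAtMostI:
  assumes "\<And>j. 1 \<le> j \<Longrightarrow> j < k \<Longrightarrow> (l j :: nat) < l (Suc j)"
  shows "strict_mono_on {1..k} l"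
  using assms
proof (induction k)
  case (Suc k)
  then show ?case
    by (subst strict_mono_on_Suc_iff) auto
qed (simp add: strict_mono_on_def)

text \<open>If \<open>k < n\<close>, the row above the bottom also has \<open>k\<close> entries. Its
  last entry is bounded only by its SE-diagonal, whose bound in row \<open>n - 1\<close> is
  \<open>m + k + 1\<close>.\<close>

definition next_bounds :: "nat \<Rightarrow> nat \<Rightarrow> nat \<Rightarrow> (nat \<Rightarrow> nat) \<Rightarrow> nat \<Rightarrow> nat" where
  "next_bounds m n k b = (if k < n then b(Suc k := Suc (m + k)) else b)"

text \<open>Restoring the bottom row is inverse to removing it: the rows that can stand directly
  above \<open>b\<close> are exactly the interlacing ones, with the right end governed by
  \<open>next_bounds\<close>.\<close>

lemma gog_with_bottom_Suc:
  assumes k: "1 \<le> k" "k \<le> Suc N" and b: "0 < b 1" "strict_mono_on {1..k} b" "b k \<le> m + k"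
  shows "bij_betw (\<lambda>(l, a). a(Suc N := (\<lambda>j. if j \<in> {1..k} then b j else 0)))
    (Sigma (interlacing (next_bounds m (Suc N) k b) (min k N))
       (gog_with_bottom (Suc m) N (min k N)))
    (gog_with_bottom m (Suc N) k b)"
proof -
  define K where "K = min k N"
  define b' where "b' = next_bounds m (Suc N) k b"
  define bot where "bot = (\<lambda>j. if j \<in> {1..k} then b j else 0)"
  have b_less: "b j < b (Suc j)" if "1 \<le> j" "Suc j \<le> k" for j
    using strict_mono_onD[OF b(2), of j "Suc j"] that by auto
  have b_pos: "0 < b j" if "j \<in> {1..k}" for j
    using strict_mono_on_leD[OF b(2), of 1 j] that b(1) by auto
  \<comment> \<open>Entries grow by at least 1 per column, so the bound on \<open>b k\<close>
    implies the SE-diagonal bound for the whole bottom row.\<close>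
  have b_le: "b j \<le> m + j" if "j \<in> {1..k}" for j
  proof -
    have "j \<le> k"
      using that by simp
    then have "b j + (k - j) \<le> b k"
      using that
    proof (induction rule: inc_induct)
      case (step i)
      then have "b i < b (Suc i)"
        by (intro b_less) auto
      with step show ?case
        by (simp add: Suc_diff_Suc[symmetric])
    qed simp
    with b(3) \<open>j \<le> k\<close> show ?thesis
      by simp
  qed
  have row_bot: "gog_row (m + Suc N) k (Suc N) bot"
    using k b_less b_pos b_le by (auto simp: gog_row_def bot_def)
  have b'_Suc: "b' (Suc j) = (if Suc j \<le> k then bot (Suc j) else Suc (m + k))" if "j \<in> {1..K}" for j
    using that k by (auto simp: b'_def next_bounds_def K_def bot_def)
  have b'_eq: "b' j = bot j" if "j \<in> {1..K}" for j
    using that by (auto simp: b'_def next_bounds_def K_def bot_def)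
  let ?F = "\<lambda>a. (\<lambda>j. if j \<in> {1..K} then a N j else 0, a(Suc N := (\<lambda>_. 0)))"
  show ?thesis
    unfolding K_def[symmetric] b'_def[symmetric] bot_def[symmetric]
  proof (rule bij_betw_byWitness[where f' = ?F]; (intro ballI image_subsetI)?)
    fix p assume "p \<in> Sigma (interlacing b' K) (gog_with_bottom (Suc m) N K)"
    then obtain l a where p: "p = (l, a)" and l: "l \<in> interlacing b' K"
      and a: "gog_trapezoid (Suc m) N K a" and a_l: "\<forall>j\<in>{1..K}. a N j = l j"
      by (auto simp: gog_with_bottom_def)
    have a_last: "a (Suc N) = (\<lambda>_. 0)"
      using a by (simp add: gog_trapezoid_rows)
    have "(\<lambda>j. if j \<in> {1..K} then a N j else 0) = l"
      using l a_l by (auto simp: interlacing_def)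
    with a_last show "?F (case p of (l, a) \<Rightarrow> a(Suc N := bot)) = p"
      by (simp add: p fun_upd_idem cong: if_cong)
    have "bot j \<le> l j \<and> (Suc j \<le> k \<longrightarrow> l j \<le> bot (Suc j))" if "j \<in> {1..K}" for j
    proof -
      have "b' j \<le> l j \<and> l j \<le> b' (Suc j)"
        using l that by (simp add: interlacing_def)
      then show ?thesis
        using b'_Suc[OF that] b'_eq[OF that] by (simp split: if_splits)
    qed
    then have "gog_trapezoid m (Suc N) k (a(Suc N := bot))"
      using a a_last a_l row_bot unfolding gog_trapezoid_Suc[OF k(2)]
      by (simp add: fun_upd_idem flip: K_def)
    then show "(case p of (l, a) \<Rightarrow> a(Suc N := bot)) \<in> gog_with_bottom m (Suc N) k b"
      by (simp add: p gog_with_bottom_def bot_def)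
  next
    fix a assume "a \<in> gog_with_bottom m (Suc N) k b"
    then have a: "gog_trapezoid m (Suc N) k a" and a_b: "\<forall>j\<in>{1..k}. a (Suc N) j = b j"
      by (auto simp: gog_with_bottom_def)
    have a': "gog_trapezoid (Suc m) N K (a(Suc N := (\<lambda>_. 0)))"
      and row: "gog_row (m + Suc N) k (Suc N) (a (Suc N))"
      and adj: "\<forall>j\<in>{1..K}. a (Suc N) j \<le> a N j \<and> (Suc j \<le> k \<longrightarrow> a N j \<le> a (Suc N) (Suc j))"
      using a unfolding gog_trapezoid_Suc[OF k(2)] K_def by auto
    have a_bot: "a (Suc N) = bot"
      using row a_b k by (auto simp: gog_row_def bot_def min_absorb2)
    then show "(case ?F a of (l, a) \<Rightarrow> a(Suc N := bot)) = a"
      by (simp add: fun_upd_idem)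
    let ?l = "\<lambda>j. if j \<in> {1..K} then a N j else 0"
    have row_N: "a N j \<le> Suc m + j \<and> (Suc j \<le> K \<longrightarrow> a N j < a N (Suc j))" if "j \<in> {1..K}" for j
    proof -
      have "gog_row (Suc m + N) K N (a N)"
        using a' that by (auto simp: gog_trapezoid_rows K_def)
      then show ?thesis
        using that by (auto simp: gog_row_def K_def)
    qed
    have "b' j \<le> ?l j \<and> ?l j \<le> b' (Suc j)" if "j \<in> {1..K}" for j
    proof (cases "Suc j \<le> k")
      case True
      then show ?thesis
        using that adj b'_Suc[OF that] b'_eq[OF that] a_bot by auto
    next
      case False
      with that have "j = k"
        by (auto simp: K_def)
      then show ?thesis
        using that adj b'_Suc[OF that] b'_eq[OF that] a_bot row_N[OF that] by auto
    qed
    moreover have "strict_mono_on {1..K} ?l"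
      by (rule strict_mono_on_atLeastAtMostI) (use row_N in auto)
    ultimately have "?l \<in> interlacing b' K"
      by (auto simp: interlacing_def)
    moreover have "a(Suc N := (\<lambda>_. 0)) \<in> gog_with_bottom (Suc m) N K ?l"
      using a' by (auto simp: gog_with_bottom_def)
    ultimately show "?F a \<in> Sigma (interlacing b' K) (gog_with_bottom (Suc m) N K)"
      by blast
  qed
qed

text \<open>A strictly increasing row of positive entries can contain a 1 only in its first
  column.\<close>

lemma num_minima_Suc:
  assumes k: "1 \<le> k" "k \<le> Suc N" and b: "0 < b 1" "strict_mono_on {1..k} b"
    and a: "a (Suc N) = (\<lambda>_. 0)"
  shows "num_minima (Suc N) k (a(Suc N := (\<lambda>j. if j \<in> {1..k} then b j else 0))) =
    (if b 1 = 1 then 1 else 0) + num_minima N (min k N) a"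
proof -
  let ?a = "a(Suc N := (\<lambda>j. if j \<in> {1..k} then b j else 0))"
  let ?A = "{(i, j) \<in> gog_positions N (min k N). a i j = 1}"
  have bottom: "1 < b j" if "1 < j" "j \<le> k" for j
    using that b(1) strict_mono_onD[OF b(2), of 1 j] by auto
  have "{(i, j) \<in> gog_positions (Suc N) k. ?a i j = 1} =
      (if b 1 = 1 then {(Suc N, 1)} else {}) \<union> ?A"
  proof (intro set_eqI iffI)
    fix x assume x: "x \<in> {(i, j) \<in> gog_positions (Suc N) k. ?a i j = 1}"
    obtain i j where ij: "x = (i, j)"
      by fastforce
    show "x \<in> (if b 1 = 1 then {(Suc N, 1)} else {}) \<union> ?A"
    proof (cases "i = Suc N")
      case True
      with x ij have "1 \<le> j" "j \<le> k" "b j = 1"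
        by (auto simp: gog_positions_def split: if_splits)
      with bottom[of j] have "j = 1" "b 1 = 1"
        by (cases "j = 1"; force)+
      then show ?thesis
        using True ij by simp
    next
      case False
      with x ij show ?thesis
        by (auto simp: gog_positions_def)
    qed
  next
    fix x assume "x \<in> (if b 1 = 1 then {(Suc N, 1)} else {}) \<union> ?A"
    then show "x \<in> {(i, j) \<in> gog_positions (Suc N) k. ?a i j = 1}"
      using k by (auto simp: gog_positions_def split: if_splits)
  qed
  moreover have "finite ?A" "(Suc N, 1) \<notin> ?A"
    by (auto simp: gog_positions_def
        intro: finite_subset[OF _ finite_gog_positions[of N "min k N"]])
  ultimately show ?thesis
    by (simp add: num_minima_def)
qed

text \<open>Neither count includes its own bottom row, so the only new candidate is row
  \<open>N\<close>, and only if it reaches column \<open>k\<close>.\<close>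

lemma num_maxima_Suc:
  assumes k: "1 \<le> k" "k \<le> Suc N"
  shows "num_maxima_above_bottom m (Suc N) k (a(Suc N := r)) =
    (if k \<le> N \<and> a N k = Suc (m + k) then 1 else 0) +
    num_maxima_above_bottom (Suc m) N (min k N) a"
proof (cases "k \<le> N")
  case True
  have "{i \<in> {k..<Suc N}. (a(Suc N := r)) i k = m + Suc N - i + k} =
      (if a N k = Suc (m + k) then {N} else {}) \<union> {i \<in> {k..<N}. a i k = Suc m + N - i + k}"
    using True by (auto simp: less_Suc_eq)
  then show ?thesis
    using True by (simp add: num_maxima_above_bottom_def min_absorb1)
next
  case False
  then have "k = Suc N"
    using k by simp
  then show ?thesis
    by (simp add: num_maxima_above_bottom_def)
qed

text \<open>The weight \<open>p\<close> of a minimum is left open: \<open>indet_P\<close> serves the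
  first formula and 1 the second.\<close>

definition gog_sum :: "coeffs \<Rightarrow> nat \<Rightarrow> nat \<Rightarrow> nat \<Rightarrow> (nat \<Rightarrow> nat) \<Rightarrow> coeffs" where
  "gog_sum p m n k b = (\<Sum>a\<in>gog_with_bottom m n k b.
     p ^ num_minima n k a * indet_Q ^ num_maxima_above_bottom m n k a)"

lemma gog_sum_0: "gog_sum p m 0 0 b = 1"
proof -
  have "gog_with_bottom m 0 0 b = {\<lambda>_ _. 0}"
    by (auto simp: gog_with_bottom_def gog_trapezoid_rows)
  then show ?thesis
    by (simp add: gog_sum_def num_minima_def num_maxima_above_bottom_def gog_positions_def)
qed

lemma gog_sum_Suc:
  assumes k: "1 \<le> k" "k \<le> Suc N" and b: "0 < b 1" "strict_mono_on {1..k} b" "b k \<le> m + k"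
  shows "gog_sum p m (Suc N) k b = (if b 1 = 1 then p else 1) *
    (\<Sum>l\<in>interlacing (next_bounds m (Suc N) k b) (min k N).
      (if k \<le> N \<and> l k = Suc (m + k) then indet_Q else 1) * gog_sum p (Suc m) N (min k N) l)"
proof -
  let ?I = "interlacing (next_bounds m (Suc N) k b) (min k N)"
  let ?G = "gog_with_bottom (Suc m) N (min k N)"
  let ?f = "\<lambda>(l, a). a(Suc N := (\<lambda>j. if j \<in> {1..k} then b j else 0))"
  let ?wt = "\<lambda>m n k a. p ^ num_minima n k a * indet_Q ^ num_maxima_above_bottom m n k a"
  have "gog_sum p m (Suc N) k b = (\<Sum>x\<in>Sigma ?I ?G. ?wt m (Suc N) k (?f x))"
    unfolding gog_sum_def
    by (rule sum.reindex_bij_betw[symmetric]) (rule gog_with_bottom_Suc[OF k b])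
  also have "\<dots> = (\<Sum>(l, a)\<in>Sigma ?I ?G. (if b 1 = 1 then p else 1) *
      ((if k \<le> N \<and> l k = Suc (m + k) then indet_Q else 1) * ?wt (Suc m) N (min k N) a))"
  proof (rule sum.cong[OF refl])
    fix x assume "x \<in> Sigma ?I ?G"
    then obtain l a where x: "x = (l, a)" and a: "a \<in> ?G l"
      by blast
    then have "a (Suc N) = (\<lambda>_. 0)" and max: "k \<le> N \<Longrightarrow> a N k = l k"
      using k by (auto simp: gog_with_bottom_def gog_trapezoid_rows)
    note min = num_minima_Suc[of k N b a, OF k b(1,2) this(1)]
    have max: "k \<le> N \<and> a N k = Suc (m + k) \<longleftrightarrow> k \<le> N \<and> l k = Suc (m + k)"
      using max by auto
    show "?wt m (Suc N) k (?f x) = (case x of (l, a) \<Rightarrow> (if b 1 = 1 then p else 1) *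
        ((if k \<le> N \<and> l k = Suc (m + k) then indet_Q else 1) * ?wt (Suc m) N (min k N) a))"
      unfolding x case_prod_conv min num_maxima_Suc[OF k] max
      by (simp add: power_add)
  qed
  also have "\<dots> = (\<Sum>l\<in>?I. \<Sum>a\<in>?G l. (if b 1 = 1 then p else 1) *
      ((if k \<le> N \<and> l k = Suc (m + k) then indet_Q else 1) * ?wt (Suc m) N (min k N) a))"
    by (subst sum.Sigma) (simp_all add: finite_interlacing finite_gog_with_bottom)
  finally show ?thesis
    by (simp only: gog_sum_def sum_distrib_left)
qed

subsection \<open>The constant term as a coefficient\<close>

text \<open>The negated exponents of the monomial prefactors, so that the constant term becomes the
  coefficient at this vector. For \<open>k < n\<close> the value at \<open>k + 1\<close> is again
  \<open>n - 1\<close>, hence \<open>k + 1\<close> variables can carry the top power of the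
  Vandermonde product.\<close>

definition exponents :: "nat \<Rightarrow> nat \<Rightarrow> nat \<Rightarrow>\<^sub>0 nat" where
  "exponents n k = (\<Sum>i\<in>{1..n}. Poly_Mapping.single i (if i \<le> k then n - 1 else n + k - i))"

lemma lookup_sum_single:
  "finite A \<Longrightarrow> Poly_Mapping.lookup (\<Sum>i\<in>A. Poly_Mapping.single i (h i)) j =
    (if j \<in> A then h j else (0 :: nat))"
  by (simp add: lookup_sum lookup_single when_def)

definition column_weight :: "nat \<Rightarrow> nat \<Rightarrow> coeffs" where
  "column_weight k j = (if j \<le> k then 0 else indet_Q)"

definition column_exponent :: "nat \<Rightarrow> nat \<Rightarrow> (nat \<Rightarrow> nat) \<Rightarrow> nat \<Rightarrow> nat" where
  "column_exponent m k b j = (if j \<le> k then b j else m + k)"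

definition first_column :: "coeffs mpoly \<Rightarrow> (nat \<Rightarrow> nat) \<Rightarrow> coeffs mpoly" where
  "first_column f b = (if b 1 = 1 then f else (1 + Var 1) ^ b 1)"

definition gog_coeff :: "coeffs mpoly \<Rightarrow> nat \<Rightarrow> nat \<Rightarrow> nat \<Rightarrow> (nat \<Rightarrow> nat) \<Rightarrow> coeffs" where
  "gog_coeff f m n k b = Poly_Mapping.lookup
     (first_column f b * (\<Prod>j\<in>{2..n}. column_factor (column_weight k) (column_exponent m k b) j) *
      kern Var {1..n} * vand Var {1..n}) (exponents n k)"

lemma geometric_sum_mult:
  fixes x :: "'a::comm_ring_1"
  assumes "a \<le> Suc c"
  shows "(\<Sum>v\<in>{a..c}. x * (1 + x) ^ v) = (1 + x) ^ Suc c - (1 + x) ^ a"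
proof -
  have "(\<Sum>v\<in>{a..c}. x * (1 + x) ^ v) = (\<Sum>v\<in>{a..c}. (1 + x) ^ Suc v - (1 + x) ^ v)"
    by (simp add: algebra_simps)
  also have "\<dots> = (1 + x) ^ Suc c - (1 + x) ^ a"
    by (rule sum_Suc_diff[OF assms])
  finally show ?thesis .
qed

text \<open>The column of a leading entry 1 contributes \<open>f\<close>, which is \<open>p (1 + x\<^sub>1)\<^sup>2 / (1 + p x\<^sub>1)\<close> up to
  a multiple of \<open>x\<^sub>1\<^sup>R\<close>. The choice \<open>p = 1\<close>, \<open>f = 1 + x\<^sub>1\<close> forgets the minima and covers the
  second formula.\<close>

locale first_factor =
  fixes f g :: "coeffs mpoly" and p :: coeffs and R :: nat
  assumes only_var_f: "only_var 1 f"
    and f_0: "\<And>s :: nat \<Rightarrow> coeffs mpoly. s 1 = 0 \<Longrightarrow> subst s f = Const p"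
    and f_eq: "f * (1 + Const p * Var 1) = Const p * (1 + Var 1) ^ 2 + g * Var 1 ^ R"
begin

definition column_term :: "nat \<Rightarrow> nat \<Rightarrow> coeffs mpoly" where
  "column_term j v = (if j = 1 \<and> v = 1 then f else (1 + Var j) ^ v)"

text \<open>The weight of an entry \<open>v\<close> in column \<open>j\<close> of the row above the
  bottom. The factor \<open>x_j\<close> makes the sums over \<open>v\<close> geometric, and
  \<open>Q\<close> marks a maximum in column \<open>k\<close>.\<close>

definition entry_term :: "nat \<Rightarrow> nat \<Rightarrow> nat \<Rightarrow> nat \<Rightarrow> nat \<Rightarrow> coeffs mpoly" where
  "entry_term m N k j v =
     Var j * (Const (if k \<le> N \<and> j = k \<and> v = Suc (m + k) then indet_Q else 1) * column_term j v)"

lemma only_var_entry_term: "only_var j (entry_term m N k j v)"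
  using only_var_f
  by (auto simp: only_var_def entry_term_def column_term_def subst.ev_simps)

lemma sum_column_term:
  assumes "2 \<le> j \<or> 1 < a" "a \<le> Suc c"
  shows "(\<Sum>v\<in>{a..c}. Var j * column_term j v) = (1 + Var j) ^ Suc c - (1 + Var j) ^ a"
proof -
  have "(\<Sum>v\<in>{a..c}. Var j * column_term j v) = (\<Sum>v\<in>{a..c}. Var j * (1 + Var j) ^ v)"
    using assms by (intro sum.cong refl) (auto simp: column_term_def)
  then show ?thesis
    by (simp add: geometric_sum_mult[OF assms(2)])
qed

text \<open>By \<open>f_eq\<close>, \<open>p x f\<close> equals \<open>p (1 + x)^2 - f\<close> up to
  the error term. Thus \<open>f\<close> takes the place of the lower end of a geometric sum starting
  at exponent 1.\<close>

lemma sum_column_term_first: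
  assumes "1 \<le> c"
  shows "Const p * (\<Sum>v\<in>{1..c}. Var 1 * column_term 1 v) =
    Const p * (1 + Var 1) ^ Suc c - (f - g * Var 1 ^ R)"
proof -
  have "(\<Sum>v\<in>{1..c}. Var 1 * column_term 1 v) =
      Var 1 * f + (\<Sum>v\<in>{Suc 1..c}. Var 1 * column_term 1 v)"
    using assms by (simp add: sum.atLeast_Suc_atMost column_term_def)
  also have "(\<Sum>v\<in>{Suc 1..c}. Var 1 * column_term 1 v) = (1 + Var 1) ^ Suc c - (1 + Var 1) ^ 2"
    using assms by (subst sum_column_term) (auto simp: numeral_2_eq_2)
  finally have "Const p * (\<Sum>v\<in>{1..c}. Var 1 * column_term 1 v) =
      f * (1 + Const p * Var 1) - f + Const p * (1 + Var 1) ^ Suc c - Const p * (1 + Var 1) ^ 2"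
    by (simp only:) (simp add: algebra_simps)
  then show ?thesis
    unfolding f_eq by (simp add: algebra_simps)
qed

text \<open>Only column \<open>k\<close> has the enlarged range. Its additional value
  \<open>m + k + 1\<close> is the maximum, of weight \<open>Q\<close>, and supplies the term that
  completes \<open>shifted_factor\<close>. In the other columns the next column weight is 0.\<close>

lemma sum_entry_term:
  fixes m N k :: nat and b :: "nat \<Rightarrow> nat"
  assumes j: "1 \<le> j" "j \<le> min k N" and k: "k \<le> Suc N" and b: "b k \<le> m + k"
  defines "C \<equiv> column_exponent m k b (Suc j)" and "b' \<equiv> next_bounds m (Suc N) k b"
  shows "(\<Sum>v\<in>{b' j..b' (Suc j)}. entry_term m N k j v) =
    (\<Sum>v\<in>{b j..C}. Var j * column_term j v) + Const (column_weight k (Suc j)) * Var j *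
        (1 + Var j) ^ Suc C"
proof (cases "j = k")
  case True
  have C: "C = m + k" and b': "b' j = b k" "b' (Suc j) = Suc C"
    using True j by (simp_all add: C_def b'_def column_exponent_def next_bounds_def)
  have "(\<Sum>v\<in>{b' j..b' (Suc j)}. entry_term m N k j v) =
      (\<Sum>v\<in>{b k..C}. entry_term m N k j v) + entry_term m N k j (Suc C)"
    unfolding b' using b C by (subst sum.cl_ivl_Suc) auto
  also have "(\<Sum>v\<in>{b k..C}. entry_term m N k j v) = (\<Sum>v\<in>{b j..C}. Var j * column_term j v)"
    using True C by (intro sum.cong) (auto simp: entry_term_def)
  also have "entry_term m N k j (Suc C) =
      Const (column_weight k (Suc j)) * Var j * (1 + Var j) ^ Suc C"
    using True C j by (simp add: entry_term_def column_term_def column_weight_def)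
  finally show ?thesis .
next
  case False
  have C: "C = b (Suc j)" and b': "b' j = b j" "b' (Suc j) = b (Suc j)"
    using False j by (auto simp add: C_def b'_def column_exponent_def next_bounds_def)
  show ?thesis
    unfolding b' C using False j by (simp add: entry_term_def column_weight_def)
qed

text \<open>\<open>constant_term_recursion\<close> applies with the entry weights. Expanding its
  \<open>row_sum\<close> over the rows \<open>l\<close> yields the coefficients for \<open>N\<close>
  rows, in the same form as \<open>gog_sum_Suc\<close>.\<close>

lemma gog_coeff_Suc:
  assumes N: "1 \<le> N" and k: "1 \<le> k" "k \<le> Suc N"
    and b: "0 < b 1" "strict_mono_on {1..k} b" "b k \<le> m + k" and R: "N < R"
  shows "gog_coeff f m (Suc N) k b = (if b 1 = 1 then p else 1) *
    (\<Sum>l\<in>interlacing (next_bounds m (Suc N) k b) (min k N).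
      (if k \<le> N \<and> l k = Suc (m + k) then indet_Q else 1) * gog_coeff f (Suc m) N (min k N) l)"
proof -
  define K where "K = min k N"
  define b' where "b' = next_bounds m (Suc N) k b"
  define c where "c = column_exponent m k b"
  define q where "q = column_weight k"
  define w where "w = entry_term m N k"
  define p' where "p' = (if b 1 = 1 then p else 1)"
  \<comment> \<open>Each of the first \<open>K\<close> columns carries one factor \<open>x_j\<close>
    from \<open>entry_term\<close>, which raises its exponent from \<open>N - 1\<close> to
    \<open>N\<close>.\<close>
  define e' where "e' = exponents N K + (\<Sum>j\<in>{1..K}. Poly_Mapping.single j 1)"
  define Y where "Y = (\<Prod>j\<in>{Suc K..N}. shifted_factor q c j)"
  have K: "1 \<le> K" "K \<le> N"
    using N k by (auto simp: K_def)
  have lookup_e: "Poly_Mapping.lookup (exponents n k') i =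
      (if i \<in> {1..n} then if i \<le> k' then n - 1 else n + k' - i else 0)" for n k' i
    unfolding exponents_def by (rule lookup_sum_single) simp
  have lookup_e': "Poly_Mapping.lookup e' i =
      Poly_Mapping.lookup (exponents N K) i + (if i \<in> {1..K} then 1 else 0)" for i
    by (simp add: e'_def lookup_add lookup_sum_single)
  have b_less: "b i < b j" if "i < j" "1 \<le> i" "j \<le> k" for i j
    using that by (intro strict_mono_onD[OF b(2)]) auto
  have b_le: "b j \<le> m + k" if "1 \<le> j" "j \<le> k" for j
    using b_less[of j k] that b(3) by (cases "j = k") auto
  have b'_eq: "b' j = b j" if "j \<le> K" for j
    using that by (auto simp: b'_def next_bounds_def K_def)
  have b'_last: "b K \<le> b' (Suc K)"
    using k b(3) b_less[of K "Suc K"] K by (cases "k \<le> N") (auto simp: b'_def next_bounds_def K_def)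
  have sum_w: "(\<Sum>v\<in>{b' j..b' (Suc j)}. w j v) =
      (\<Sum>v\<in>{b j..c (Suc j)}. Var j * column_term j v) + Const (q (Suc j)) * Var j *
          (1 + Var j) ^ Suc (c (Suc j))"
    if "1 \<le> j" "j \<le> K" for j
    unfolding w_def b'_def c_def q_def using that k b(3)
    by (intro sum_entry_term) (auto simp: K_def)
  have c_ge: "b j \<le> c (Suc j)" if "1 \<le> j" "j \<le> K" for j
    using that b_less[of j "Suc j"] b_le[of j] by (auto simp: c_def column_exponent_def K_def)
  have "gog_coeff f m (Suc N) k b = Poly_Mapping.lookup
      (Const p' * row_sum w b' K * Y * kern Var {1..N} * vand Var {1..N}) e'"
    unfolding gog_coeff_def Y_def q_def[symmetric] c_def[symmetric]
  proof (rule constant_term_recursion[where R = R and g = "if b 1 = 1 then g else 0"])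
    show "only_var 1 (first_column f b)"
      using only_var_f by (auto simp: first_column_def only_var_def subst.ev_simps)
    show "subst s (first_column f b) = Const p'" if "s 1 = 0" for s :: "nat \<Rightarrow> coeffs mpoly"
      using f_0[of s, OF that] that by (simp add: first_column_def p'_def subst.ev_simps)
    show "Const p' * (\<Sum>v\<in>{b' 1..b' 2}. w 1 v) =
        Const p' * shifted_factor q c 1 -
            (first_column f b - (if b 1 = 1 then g else 0) * Var 1 ^ R)"
    proof (cases "b 1 = 1")
      case True
      have "Const p * (\<Sum>v\<in>{b' 1..b' 2}. w 1 v) =
          Const p * (\<Sum>v\<in>{1..c 2}. Var 1 * column_term 1 v) + Const p *
              (Const (q 2) * Var 1 * (1 + Var 1) ^ Suc (c 2))"
        using sum_w[of 1] K True by (simp add: numeral_2_eq_2 distrib_left)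
      also have "\<dots> = Const p * (1 + Var 1) ^ Suc (c 2) - (f - g * Var 1 ^ R)
          + Const p * (Const (q 2) * Var 1 * (1 + Var 1) ^ Suc (c 2))"
        using c_ge[of 1] K True by (subst sum_column_term_first) (simp_all add: numeral_2_eq_2)
      finally show ?thesis
        using True by (simp add: p'_def first_column_def shifted_factor_def algebra_simps
            numeral_2_eq_2)
    next
      case False
      then have "(\<Sum>v\<in>{b 1..c 2}. Var 1 * column_term 1 v) =
          (1 + Var 1) ^ Suc (c 2) - (1 + Var 1) ^ b 1"
        using c_ge[of 1] K b(1) by (intro sum_column_term) (auto simp: numeral_2_eq_2)
      then have "(\<Sum>v\<in>{b' 1..b' 2}. w 1 v) =
          (1 + Var 1) ^ Suc (c 2) - (1 + Var 1) ^ b 1 +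
            Const (q 2) * Var 1 * (1 + Var 1) ^ Suc (c 2)"
        using sum_w[of 1] K by (simp add: numeral_2_eq_2)
      with False show ?thesis
        by (simp add: p'_def first_column_def shifted_factor_def algebra_simps numeral_2_eq_2)
    qed
    show "(\<Sum>v\<in>{b' j..b' (Suc j)}. w j v) = shifted_factor q c j - column_factor q c j"
      if "2 \<le> j" "j \<le> K" for j
    proof -
      have "(\<Sum>v\<in>{b j..c (Suc j)}. Var j * column_term j v) =
          (1 + Var j) ^ Suc (c (Suc j)) - (1 + Var j) ^ b j"
        using that c_ge[of j] by (intro sum_column_term) auto
      moreover have "column_factor q c j = (1 + Var j) ^ b j"
        using that by (simp add: column_factor_def q_def c_def column_weight_def
            column_exponent_def K_def)
      ultimately show ?thesis
        using that sum_w[of j] by (simp add: shifted_factor_def algebra_simps)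
    qed
    show "w j (c (Suc j)) = Var j * (1 + Var j) ^ c (Suc j)" if "1 \<le> j" "j < K" for j
    proof -
      have "c (Suc j) = b (Suc j)" "1 < b (Suc j)" "j \<noteq> k"
        using that b_less[of 1 "Suc j"] b(1) by (auto simp: c_def column_exponent_def K_def)
      then show ?thesis
        by (simp add: w_def entry_term_def column_term_def)
    qed
    show "w j (c j) = Var j * (1 + Var j) ^ c j" if "2 \<le> j" "j \<le> K" for j
    proof -
      have "c j = b j" "b j \<le> m + k"
        using that b_le[of j] by (auto simp: c_def column_exponent_def K_def)
      then show ?thesis
        using that by (simp add: w_def entry_term_def column_term_def)
    qed
    show "b' j < b' (Suc j)" if "1 \<le> j" "j < K" for j
      using that b_less[of j "Suc j"] by (simp add: b'_eq K_def)
    show "b' j = c j" if "1 \<le> j" "j \<le> K" for j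
      using that by (simp add: b'_eq c_def column_exponent_def K_def)
  qed (use K k b'_last R in \<open>auto simp: only_var_entry_term w_def lookup_e lookup_e' b'_eq q_def
      column_weight_def K_def split: if_splits\<close>)
  also have "\<dots> = p' * (\<Sum>l\<in>interlacing b' K. Poly_Mapping.lookup
      ((\<Prod>j\<in>{1..K}. w j (l j)) * Y * kern Var {1..N} * vand Var {1..N}) e')"
    by (simp only: row_sum_def sum_distrib_left sum_distrib_right lookup_sum mult.assoc
        lookup_Const_mult)
  also have "\<dots> = p' * (\<Sum>l\<in>interlacing b' K.
      (if k \<le> N \<and> l k = Suc (m + k) then indet_Q else 1) * gog_coeff f (Suc m) N K l)"
  proof (intro arg_cong2[where f = "(*)"] refl sum.cong)
    fix l assume "l \<in> interlacing b' K"
    define Qt where "Qt = (if k \<le> N \<and> l k = Suc (m + k) then indet_Q else 1)"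
    let ?c = "column_exponent (Suc m) K l" and ?q = "column_weight K"
    have w_split: "w j (l j) = Var j * (Const (if j = k then Qt else 1) * column_term j (l j))"
      if "j \<in> {1..K}" for j
      using that by (simp add: w_def entry_term_def Qt_def K_def)
    have "(\<Prod>j\<in>{1..K}. w j (l j)) =
        (\<Prod>j\<in>{1..K}. Var j * (Const (if j = k then Qt else 1) * column_term j (l j)))"
      by (intro prod.cong refl w_split)
    also have "\<dots> = (\<Prod>j\<in>{1..K}. Var j) * ((\<Prod>j\<in>{1..K}. Const (if j = k then Qt else 1)) *
        (\<Prod>j\<in>{1..K}. column_term j (l j)))"
      by (simp only: prod.distrib)
    also have "(\<Prod>j\<in>{1..K}. Var j :: coeffs mpoly) =
        Poly_Mapping.single (\<Sum>j\<in>{1..K}. Poly_Mapping.single j 1) 1"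
      by (simp add: single_sum_one Var_def)
    also have "(\<Prod>j\<in>{1..K}. Const (if j = k then Qt else 1)) = Const Qt"
    proof (cases "k \<le> N")
      case True
      then have "(\<Prod>j\<in>{1..K}. Const (if j = k then Qt else 1)) =
          (\<Prod>j\<in>{1..K}. if j = k then Const Qt else 1)"
        by (intro prod.cong) auto
      with True k show ?thesis
        by (simp add: K_def)
    next
      case False
      then have "Qt = 1" "k \<notin> {1..K}"
        by (auto simp: Qt_def K_def)
      then show ?thesis
        by (auto intro!: prod.neutral)
    qed
    also have "(\<Prod>j\<in>{1..K}. column_term j (l j)) =
        first_column f l * (\<Prod>j\<in>{2..K}. column_factor ?q ?c j)"
    proof -
      have "(\<Prod>j\<in>{1..K}. column_term j (l j)) =
          column_term 1 (l 1) * (\<Prod>j\<in>{Suc 1..K}. column_term j (l j))"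
        using K by (intro prod.atLeast_Suc_atMost)
      also have "(\<Prod>j\<in>{Suc 1..K}. column_term j (l j)) = (\<Prod>j\<in>{2..K}. column_factor ?q ?c j)"
        by (intro prod.cong)
          (auto simp: column_term_def column_factor_def column_weight_def column_exponent_def)
      finally show ?thesis
        by (simp add: column_term_def first_column_def)
    qed
    finally have w_prod: "(\<Prod>j\<in>{1..K}. w j (l j)) =
        Poly_Mapping.single (\<Sum>j\<in>{1..K}. Poly_Mapping.single j 1) 1 *
        (Const Qt * (first_column f l * (\<Prod>j\<in>{2..K}. column_factor ?q ?c j)))" .
    \<comment> \<open>The additional factor \<open>1 + x_j\<close> in a shifted column raises the
      exponent \<open>m + k\<close> to \<open>Suc m + k\<close>, as required for the trapezoid with
      parameter \<open>Suc m\<close>.\<close>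
    have "Y = (\<Prod>j\<in>{Suc K..N}. column_factor ?q ?c j)"
      unfolding Y_def by (intro prod.cong refl)
        (auto simp: shifted_factor_def column_factor_def q_def c_def column_weight_def
          column_exponent_def K_def)
    moreover have "{2..N} = {2..K} \<union> {Suc K..N}"
      using K by auto
    then have "(\<Prod>j\<in>{2..N}. column_factor ?q ?c j) =
        (\<Prod>j\<in>{2..K}. column_factor ?q ?c j) * (\<Prod>j\<in>{Suc K..N}. column_factor ?q ?c j)"
      by (simp add: prod.union_disjoint)
    ultimately have "(\<Prod>j\<in>{1..K}. w j (l j)) * Y * kern Var {1..N} * vand Var {1..N} =
        Const Qt * (first_column f l * (\<Prod>j\<in>{2..N}. column_factor ?q ?c j) *
          kern Var {1..N} * vand Var {1..N}) * Poly_Mapping.single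
              (\<Sum>j\<in>{1..K}. Poly_Mapping.single j 1) 1"
      unfolding w_prod by (simp only: mult_ac)
    then show "Poly_Mapping.lookup ((\<Prod>j\<in>{1..K}. w j (l j)) * Y * kern Var {1..N} *
        vand Var {1..N}) e' =
        (if k \<le> N \<and> l k = Suc (m + k) then indet_Q else 1) * gog_coeff f (Suc m) N K l"
      unfolding e'_def gog_coeff_def Qt_def[symmetric]
      by (simp only: lookup_monom_mult lookup_Const_mult)
  qed
  finally show ?thesis
    by (simp only: p'_def b'_def K_def)
qed

lemma lookup_f_0: "Poly_Mapping.lookup f 0 = p"
proof -
  have "Poly_Mapping.lookup (subst (\<lambda>j. if j \<in> {1} then 0 else Var
      (if j < 1 then j else j - 1)) f) 0 =
      Poly_Mapping.lookup f 0"
    by (rule lookup_subst_renaming, rule bij_betwI[of _ _ _ "\<lambda>j. if j < 1 then j else Suc j"]) auto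
  then show ?thesis
    by (simp add: f_0 Const_def)
qed

text \<open>Induction on the number of rows, since both sides obey the same recursion. The
  parameters \<open>m\<close>, \<open>k\<close> and \<open>b\<close> vary, because removing a row
  changes all three.\<close>

lemma gog_sum_eq_gog_coeff:
  assumes "1 \<le> k" "k \<le> n" "n \<le> R" "0 < b 1" "strict_mono_on {1..k} b" "b k \<le> m + k"
  shows "gog_sum p m n k b = gog_coeff f m n k b"
  using assms
proof (induction n arbitrary: m k b)
  case (Suc N)
  \<comment> \<open>The recursion for \<open>gog_coeff\<close> requires a remaining row, so a single
    row is computed directly: both sides are then the weight of the entry as a minimum.\<close>
  show ?case
  proof (cases "N = 0")
    case True
    then have k: "k = 1"
      using Suc.prems by simp
    have "Poly_Mapping.lookup ((1 + Var 1) ^ v :: coeffs mpoly) 0 = 1" for v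
    proof -
      have "Poly_Mapping.lookup (subst (\<lambda>j. if j \<in> {1} then 0 else Var (if j < 1 then j else j - 1))
          ((1 + Var 1) ^ v :: coeffs mpoly)) 0 = Poly_Mapping.lookup ((1 + Var 1) ^ v) 0"
        by (rule lookup_subst_renaming,
            rule bij_betwI[of _ _ _ "\<lambda>j. if j < 1 then j else Suc j"]) auto
      then show ?thesis
        by (simp add: subst.ev_simps)
    qed
    moreover have "pairs {Suc 0} = {}"
      by (auto simp: pairs_def)
    ultimately have "gog_coeff f m 1 1 b = (if b 1 = 1 then p else 1)"
      using lookup_f_0 by (simp add: gog_coeff_def exponents_def kern_def vand_def first_column_def)
    moreover have "gog_sum p m 1 1 b = (if b 1 = 1 then p else 1)"
      using gog_sum_Suc[of 1 0 b m p] Suc.prems k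
      by (simp add: gog_sum_0 interlacing_0)
    ultimately show ?thesis
      using True k by simp
  next
    case False
    have "gog_sum p (Suc m) N (min k N) l = gog_coeff f (Suc m) N (min k N) l"
      if l: "l \<in> interlacing (next_bounds m (Suc N) k b) (min k N)" for l
    proof (rule Suc.IH)
      let ?b = "next_bounds m (Suc N) k b"
      have l_bounds: "?b j \<le> l j \<and> l j \<le> ?b (Suc j)" if "j \<in> {1..min k N}" for j
        using l that by (simp add: interlacing_def)
      show "0 < l 1"
        using l_bounds[of 1] Suc.prems False by (auto simp: next_bounds_def split: if_splits)
      show "l (min k N) \<le> Suc m + min k N"
        using l_bounds[of "min k N"] Suc.prems False
        by (cases "k \<le> N") (auto simp: next_bounds_def min_def le_Suc_eq)
      show "strict_mono_on {1..min k N} l"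
        using l by (simp add: interlacing_def)
    qed (use Suc.prems False in auto)
    then show ?thesis
      using Suc.prems False by (simp add: gog_sum_Suc gog_coeff_Suc)
  qed
qed simp

end

subsection \<open>Laurent series\<close>

interpretation scal: coeff_hom scal
  by unfold_locales (simp_all add: scal_def single_add mult_single fls_const_mult_const
      fls_plus_const)

abbreviation to_laurent :: "coeffs mpoly \<Rightarrow> laurent" where
  "to_laurent \<equiv> eval_mpoly scal xvar"

lemma const_term_add: "const_term (F + G) = const_term F + const_term G"
  by (simp add: const_term_def lookup_add)

lemma const_term_sum: "const_term (sum h A) = (\<Sum>i\<in>A. const_term (h i))"
  by (induction A rule: infinite_finite_induct)
      (simp_all add: const_term_add, simp_all add: const_term_def)

lemma const_term_scal_mult: "const_term (scal c * F) = c * const_term F"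
proof -
  have "Poly_Mapping.lookup (Poly_Mapping.single 0 c * (q :: (nat \<Rightarrow>\<^sub>0 int) \<Rightarrow>\<^sub>0 coeffs)) 0 =
      c * Poly_Mapping.lookup q 0" for q
    unfolding mult_map_scale_conv_mult[symmetric] by (simp add: Poly_Mapping.map.rep_eq when_def)
  then show ?thesis
    by (simp add: const_term_def scal_def)
qed

lemma xpow_power: "xvar i ^ e = xpow i (int e)"
  by (induction e) (simp_all add: xvar_def xpow_0 xpow_mult)

text \<open>The exponent of \<open>x_1\<close> is read off as the index in the Laurent series, and
  the other exponents as the exponent vector of its coefficient.\<close>

lemma const_term_xpow_prod:
  assumes S: "finite S" "1 \<in> S"
  shows "const_term (\<Prod>i\<in>S. xpow i (d i)) = (if \<forall>i\<in>S. d i = 0 then 1 else 0)"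
proof -
  define a where "a = (\<Sum>i\<in>S - {1}. Poly_Mapping.single i (d i))"
  have lookup_a: "Poly_Mapping.lookup a j = (if j \<in> S - {1} then d j else 0)" for j
    using S by (simp add: a_def lookup_sum lookup_single when_def)
  have "(\<Prod>i\<in>S - {1}. xpow i (d i)) = fls_const (Poly_Mapping.single a 1)"
  proof -
    have "(\<Prod>i\<in>A. xpow i (d i)) =
        fls_const (Poly_Mapping.single (\<Sum>i\<in>A. Poly_Mapping.single i (d i)) 1)"
      if "finite A" "1 \<notin> A" for A
      using that
      by (induction A rule: finite_induct) (auto simp: xpow_def fls_const_mult_const mult_single)
    then show ?thesis
      using S by (simp add: a_def)
  qed
  then have "(\<Prod>i\<in>S. xpow i (d i)) = fls_X_intpow (d 1) * fls_const (Poly_Mapping.single a 1)"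
    using S by (simp add: prod.remove[of S 1] xpow_def)
  then have "fls_nth (\<Prod>i\<in>S. xpow i (d i)) 0 = (if d 1 = 0 then Poly_Mapping.single a 1 else 0)"
    by (simp add: fls_X_intpow_times_conv_shift)
  moreover have "a = 0 \<longleftrightarrow> (\<forall>i\<in>S - {1}. d i = 0)"
    by (auto simp: poly_mapping_eq_iff fun_eq_iff lookup_a)
  ultimately show ?thesis
    using S by (auto simp: const_term_def lookup_single when_def)
qed

text \<open>By linearity it suffices to treat a monomial. Divided by the monomial of
  \<open>e\<close>, it has constant term 1 if its exponent vector is \<open>e\<close>, and 0
  otherwise.\<close>

lemma const_term_to_laurent:
  assumes "1 \<le> n" and e: "\<And>i. Poly_Mapping.lookup e i = (if i \<in> {1..n} then d i else 0)"
  shows "const_term (to_laurent F * (\<Prod>i\<in>{1..n}. xpow i (- int (d i)))) = Poly_Mapping.lookup F e"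
proof -
  have "const_term (monom_eval xvar a * (\<Prod>i\<in>{1..n}. xpow i (- int (d i)))) =
      (if a = e then 1 else 0)" for a
  proof -
    let ?S = "Poly_Mapping.keys a \<union> {1..n}"
    have "monom_eval xvar a = (\<Prod>i\<in>?S. xpow i (int (Poly_Mapping.lookup a i)))"
      by (subst monom_eval_superset[of ?S]) (simp_all add: xpow_power)
    moreover have "(\<Prod>i\<in>{1..n}. xpow i (- int (d i))) =
        (\<Prod>i\<in>?S. xpow i (- int (Poly_Mapping.lookup e i)))"
      by (rule prod.mono_neutral_cong_left) (auto simp: e xpow_0)
    ultimately have "monom_eval xvar a * (\<Prod>i\<in>{1..n}. xpow i (- int (d i))) =
        (\<Prod>i\<in>?S. xpow i (int (Poly_Mapping.lookup a i) - int (Poly_Mapping.lookup e i)))"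
      by (simp add: prod.distrib[symmetric] xpow_mult)
    also have "const_term \<dots> = (if \<forall>i\<in>?S. int (Poly_Mapping.lookup a i) -
        int (Poly_Mapping.lookup e i) = 0 then 1 else 0)"
      using assms(1) by (intro const_term_xpow_prod) auto
    also have "(\<forall>i\<in>?S. int (Poly_Mapping.lookup a i) - int (Poly_Mapping.lookup e i) = 0) \<longleftrightarrow> a = e"
    proof
      assume *: "\<forall>i\<in>?S. int (Poly_Mapping.lookup a i) - int (Poly_Mapping.lookup e i) = 0"
      show "a = e"
      proof (rule poly_mapping_eqI)
        fix i
        show "Poly_Mapping.lookup a i = Poly_Mapping.lookup e i"
          using * e[of i] by (cases "i \<in> ?S") (auto simp: in_keys_iff)
      qed
    qed simp
    finally show ?thesis .
  qed
  then have "const_term (to_laurent F * (\<Prod>i\<in>{1..n}. xpow i (- int (d i)))) =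
      (\<Sum>a\<in>Poly_Mapping.keys F. Poly_Mapping.lookup F a * (if a = e then 1 else 0))"
    by (simp add: eval_mpoly_def sum_distrib_right mult.assoc const_term_sum const_term_scal_mult)
  also have "\<dots> = Poly_Mapping.lookup F e"
    by (simp add: if_distrib in_keys_iff cong: if_cong)
  finally show ?thesis .
qed

section \<open>Laurent series without negative powers of \<open>x_1\<close>\<close>

definition regular :: "laurent \<Rightarrow> bool" where
  "regular F \<longleftrightarrow> F \<in> range fps_to_fls"

lemma regularI: "F = fps_to_fls h \<Longrightarrow> regular F"
  by (simp add: regular_def)

lemma regular_mult: "regular F \<Longrightarrow> regular G \<Longrightarrow> regular (F * G)"
  by (auto simp: regular_def simp flip: fls_times_fps_to_fls)

lemma regular_add: "regular F \<Longrightarrow> regular G \<Longrightarrow> regular (F + G)"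
  by (auto simp: regular_def simp flip: fps_to_fls_plus)

lemma regular_1: "regular 1"
  by (rule regularI[of _ 1]) simp

lemma regular_const: "regular (fls_const c)"
  by (rule regularI[of _ "fps_const c"]) simp

lemma regular_scal: "regular (scal c)"
  by (simp add: scal_def regular_const)

lemma regular_prod: "(\<And>i. i \<in> A \<Longrightarrow> regular (h i)) \<Longrightarrow> regular (prod h A)"
  by (induction A rule: infinite_finite_induct) (simp_all add: regular_1 regular_mult)

lemma regular_power: "regular F \<Longrightarrow> regular (F ^ e)"
  by (induction e) (simp_all add: regular_1 regular_mult)

lemma regular_xpow: "i \<noteq> 1 \<Longrightarrow> regular (xpow i e)"
  by (simp add: xpow_def regular_const)

lemma regular_xvar: "regular (xvar i)"
proof (cases "i = 1")
  case True
  then show ?thesis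
    by (intro regularI[of _ fps_X]) (simp add: xvar_def xpow_def fls_X_conv_shift_1)
qed (simp add: xvar_def regular_xpow)

text \<open>Every term of such a product contains a positive power of \<open>x_1\<close>. This
  disposes of the tail of the inverse series.\<close>

lemma const_term_regular_mult_xvar_1:
  assumes "regular F"
  shows "const_term (F * xvar 1) = 0"
proof -
  obtain h where "F = fps_to_fls h"
    using assms by (auto simp: regular_def)
  then show ?thesis
    by (simp add: const_term_def xvar_def xpow_def fls_X_intpow_times_conv_shift)
qed

text \<open>Splits the columns at \<open>k\<close>, where \<open>column_weight\<close> and
  \<open>column_exponent\<close> change, and distributes the monomials over them. The first column
  stays an arbitrary \<open>F\<close>, so that both formulas are covered.\<close>

lemma to_laurent_gog_coeff:
  assumes k: "1 \<le> k" "k \<le> n"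
  shows "to_laurent (F * (\<Prod>j\<in>{2..n}. column_factor (column_weight k) (column_exponent m k b) j) *
      kern Var {1..n} * vand Var {1..n}) *
      (\<Prod>i\<in>{1..n}. xpow i (- int (if i \<le> k then n - 1 else n + k - i))) =
    to_laurent F * xpow 1 (- int n + 1) *
      (\<Prod>i\<in>{2..k}. (1 + xvar i) ^ b i * xpow i (- int n + 1)) *
      (\<Prod>i\<in>{k+1..n}. (1 + scal indet_Q * xvar i) * (1 + xvar i) ^ (m + k) *
         xpow i (- int n + int i - int k)) *
      (\<Prod>(i, j) \<in> {(i, j). 1 \<le> i \<and> i < j \<and> j \<le> n}.
         (xvar i - xvar j) * (1 + xvar j + xvar i * xvar j))"
proof -
  let ?c = "\<lambda>j. to_laurent (column_factor (column_weight k) (column_exponent m k b) j)"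
  let ?x = "\<lambda>i. xpow i (- int (if i \<le> k then n - 1 else n + k - i))"
  have ivl: "{1..n} = insert 1 {2..n}" "{2..n} = {2..k} \<union> {k+1..n}"
    using k by auto
  have "{(i, j). 1 \<le> i \<and> i < j \<and> j \<le> n} = pairs {1..n}"
    by (auto simp: pairs_def)
  then have "(\<Prod>(i, j) \<in> {(i, j). 1 \<le> i \<and> i < j \<and> j \<le> n}.
      (xvar i - xvar j) * (1 + xvar j + xvar i * xvar j)) = vand xvar {1..n} * kern xvar {1..n}"
    by (simp add: vand_def kern_def case_prod_unfold prod.distrib)
  moreover have "(\<Prod>i\<in>{1..n}. ?x i) = ?x 1 * (\<Prod>i\<in>{2..n}. ?x i)"
    by (subst ivl(1), subst prod.insert) auto
  moreover have "?x 1 = xpow 1 (- int n + 1)"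
    using k by (simp add: of_nat_diff)
  moreover have "(\<Prod>j\<in>{2..n}. ?c j) * (\<Prod>i\<in>{2..n}. ?x i) =
      (\<Prod>i\<in>{2..k}. (1 + xvar i) ^ b i * xpow i (- int n + 1)) *
      (\<Prod>i\<in>{k+1..n}. (1 + scal indet_Q * xvar i) * (1 + xvar i) ^ (m + k) *
         xpow i (- int n + int i - int k))"
  proof -
    have "(\<Prod>j\<in>{2..n}. ?c j) * (\<Prod>i\<in>{2..n}. ?x i) = (\<Prod>j\<in>{2..n}. ?c j * ?x j)"
      by (simp only: prod.distrib)
    also have "\<dots> = (\<Prod>j\<in>{2..k}. ?c j * ?x j) * (\<Prod>j\<in>{k+1..n}. ?c j * ?x j)"
      unfolding ivl(2) by (rule prod.union_disjoint) auto
    also have "(\<Prod>j\<in>{2..k}. ?c j * ?x j) = (\<Prod>i\<in>{2..k}. (1 + xvar i) ^ b i * xpow i (- int n + 1))"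
      using k by (intro prod.cong)
        (auto simp: column_factor_def column_weight_def column_exponent_def scal.ev_simps
            of_nat_diff)
    also have "(\<Prod>j\<in>{k+1..n}. ?c j * ?x j) = (\<Prod>i\<in>{k+1..n}. (1 + scal indet_Q * xvar i) *
        (1 + xvar i) ^ (m + k) * xpow i (- int n + int i - int k))"
      using k by (intro prod.cong)
        (auto simp: column_factor_def column_weight_def column_exponent_def scal.ev_simps
            of_nat_diff
          algebra_simps)
    finally show ?thesis .
  qed
  ultimately show ?thesis
    by (simp only: scal.ev_mult scal.ev_prod scal.ev_kern scal.ev_vand scal.ev_Var mult_ac)
qed

lemma gog_coeff_const_term:
  assumes k: "1 \<le> k" "k \<le> n"
  shows "gog_coeff f m n k b = const_term
    (to_laurent (first_column f b) * xpow 1 (- int n + 1) *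
      (\<Prod>i\<in>{2..k}. (1 + xvar i) ^ b i * xpow i (- int n + 1)) *
      (\<Prod>i\<in>{k+1..n}. (1 + scal indet_Q * xvar i) * (1 + xvar i) ^ (m + k) *
         xpow i (- int n + int i - int k)) *
      (\<Prod>(i, j) \<in> {(i, j). 1 \<le> i \<and> i < j \<and> j \<le> n}.
         (xvar i - xvar j) * (1 + xvar j + xvar i * xvar j)))"
  unfolding to_laurent_gog_coeff[OF k, symmetric] gog_coeff_def
  by (rule const_term_to_laurent[symmetric])
    (use k in \<open>auto simp: exponents_def lookup_sum_single\<close>)

text \<open>Truncating \<open>(1 + P x\<^sub>1)\<^sup>-\<^sup>1\<close> at \<open>x\<^sub>1\<^sup>n\<close> does not change the constant term, as \<open>x\<^sub>1\<close> has
  no exponent below \<open>1 - n\<close> in the other factors.\<close>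

definition truncated_first :: "nat \<Rightarrow> coeffs mpoly" where
  "truncated_first n = Const indet_P * (1 + Var 1) ^ 2 * (\<Sum>r<n. (Const (- indet_P) * Var 1) ^ r)"

lemma truncated_first_mult:
  "truncated_first n * (1 + Const indet_P * Var 1) = Const indet_P * (1 + Var 1) ^ 2 +
    (- (Const indet_P * (1 + Var 1) ^ 2 * Const (- indet_P) ^ n)) * Var 1 ^ n"
proof -
  have "(1 - Const (- indet_P) * Var 1) * (\<Sum>r<n. (Const (- indet_P) * Var 1) ^ r) =
      1 - (Const (- indet_P) * Var 1 :: coeffs mpoly) ^ n"
    by (rule one_diff_power_eq[symmetric])
  then have "truncated_first n * (1 + Const indet_P * Var 1) =
      Const indet_P * (1 + Var 1) ^ 2 * (1 - (Const (- indet_P) * Var 1) ^ n)"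
    by (simp add: truncated_first_def Const_uminus mult_ac)
  then show ?thesis
    by (simp add: power_mult_distrib right_diff_distrib mult.assoc)
qed

text \<open>Multiplying \<open>truncated_first_mult\<close> by the inverse series exhibits the
  neglected tail as an explicit multiple of the \<open>n\<close>-th power of
  \<open>x_1\<close>.\<close>

lemma inverse_truncated:
  "scal indet_P * inverse_one_plus_P_x1 * (1 + xvar 1) ^ 2 = to_laurent (truncated_first n) +
    scal indet_P * (1 + xvar 1) ^ 2 * scal (- indet_P) ^ n * inverse_one_plus_P_x1 * xvar 1 ^ n"
proof -
  let ?I = inverse_one_plus_P_x1 and ?A = "scal indet_P * (1 + xvar 1) ^ 2"
  have "to_laurent (truncated_first n) * (1 + scal indet_P * xvar 1) =
      ?A + (- (?A * scal (- indet_P) ^ n)) * xvar 1 ^ n"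
    using arg_cong[OF truncated_first_mult[of n], of to_laurent]
    by (simp only: scal.ev_simps scal.ev_Var scal.ev_Const scal.ev_1)
  then have "to_laurent (truncated_first n) * ((1 + scal indet_P * xvar 1) * ?I) =
      (?A + (- (?A * scal (- indet_P) ^ n)) * xvar 1 ^ n) * ?I"
    by (simp only: mult.assoc[symmetric])
  then show ?thesis
    unfolding inverse_one_plus_P_x1 by (simp add: algebra_simps)
qed

lemma regular_inverse: "regular inverse_one_plus_P_x1"
  unfolding inverse_one_plus_P_x1_def by (rule regularI[OF refl])

theorem theorem3p3:
  fixes m n k :: nat
  assumes "1 \<le> k" and "k \<le> n"
  shows
    "(\<forall>b :: nat \<Rightarrow> nat. b 1 = 1 \<and> strict_mono_on {1..k} b \<and> b k \<le> m + k \<longrightarrow>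
        (\<Sum>a \<in> gog_with_bottom m n k b.
           indet_P ^ num_minima n k a * indet_Q ^ num_maxima_above_bottom m n k a) =
        const_term
          (scal indet_P * inverse_one_plus_P_x1 * (1 + xvar 1) ^ 2 * xpow 1 (- int n + 1) *
           (\<Prod>i\<in>{2..k}. (1 + xvar i) ^ b i * xpow i (- int n + 1)) *
           (\<Prod>i\<in>{k+1..n}. (1 + scal indet_Q * xvar i) * (1 + xvar i) ^ (m + k) *
              xpow i (- int n + int i - int k)) *
           (\<Prod>(i, j) \<in> {(i, j). 1 \<le> i \<and> i < j \<and> j \<le> n}.
              (xvar i - xvar j) * (1 + xvar j + xvar i * xvar j)))) \<and>
     (\<forall>b :: nat \<Rightarrow> nat. 0 < b 1 \<and> strict_mono_on {1..k} b \<and> b k \<le> m + k \<longrightarrow>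
        (\<Sum>a \<in> gog_with_bottom m n k b. indet_Q ^ num_maxima_above_bottom m n k a) =
        const_term
          ((\<Prod>i\<in>{1..k}. (1 + xvar i) ^ b i * xpow i (- int n + 1)) *
           (\<Prod>i\<in>{k+1..n}. (1 + scal indet_Q * xvar i) * (1 + xvar i) ^ (m + k) *
              xpow i (- int n + int i - int k)) *
           (\<Prod>(i, j) \<in> {(i, j). 1 \<le> i \<and> i < j \<and> j \<le> n}.
              (xvar i - xvar j) * (1 + xvar j + xvar i * xvar j))))"
proof (intro conjI allI impI; elim conjE)
  fix b :: "nat \<Rightarrow> nat"
  assume b: "b 1 = 1" "strict_mono_on {1..k} b" "b k \<le> m + k"
  let ?f = "truncated_first n"
  define B where "B = (\<Prod>i\<in>{2..k}. (1 + xvar i) ^ b i * xpow i (- int n + 1))"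
  define C where "C = (\<Prod>i\<in>{k+1..n}. (1 + scal indet_Q * xvar i) * (1 + xvar i) ^ (m + k) *
    xpow i (- int n + int i - int k))"
  define D where "D = (\<Prod>(i, j) \<in> {(i, j). 1 \<le> i \<and> i < j \<and> j \<le> n}.
    (xvar i - xvar j) * (1 + xvar j + xvar i * xvar j))"
  define E where "E = scal indet_P * (1 + xvar 1) ^ 2 * scal (- indet_P) ^ n *
      inverse_one_plus_P_x1"
  \<comment> \<open>The error of the truncated geometric series begins at the \<open>n\<close>-th
    power of \<open>x_1\<close>, so \<open>R = n\<close>.\<close>
  interpret first_factor ?f "- (Const indet_P * (1 + Var 1) ^ 2 * Const (- indet_P) ^ n)" indet_P n
  proof
    show "only_var 1 ?f"
      by (simp add: only_var_def truncated_first_def subst.ev_simps)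
    show "subst s ?f = Const indet_P" if "s 1 = 0" for s :: "nat \<Rightarrow> coeffs mpoly"
    proof -
      obtain n' where "n = Suc n'"
        using assms by (cases n) auto
      with that show ?thesis
        by (simp add: truncated_first_def subst.ev_simps lessThan_Suc_atMost sum.atMost_shift)
    qed
  qed (rule truncated_first_mult)
  have diff: "regular (xvar i - xvar j)" for i j
    using regular_add[OF regular_xvar regular_mult[OF regular_scal[of "- 1"] regular_xvar], of i j]
    by (simp add: scal.c_1 scal_def single_uminus)
  have regular: "regular (E * B * C * D)"
    unfolding E_def B_def C_def D_def case_prod_unfold using assms
    by (intro regular_mult regular_prod regular_scal regular_power regular_add regular_1
        regular_xvar regular_xpow regular_inverse diff) auto
  have "gog_sum indet_P m n k b = gog_coeff ?f m n k b"
    using assms b by (intro gog_sum_eq_gog_coeff) auto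
  also have "\<dots> = const_term (to_laurent ?f * xpow 1 (- int n + 1) * B * C * D)"
    using b(1) by (simp only: gog_coeff_const_term[OF assms] first_column_def B_def C_def D_def
        if_True simp_thms)
  \<comment> \<open>The added term is 0. Once \<open>x_1\<close> is written as its
    \<open>n\<close>-th power times the prefactor of exponent \<open>1 - n\<close>, that term is the
    contribution of the tail of the inverse series.\<close>
  also have "\<dots> = const_term (to_laurent ?f * xpow 1 (- int n + 1) * B * C * D) +
      const_term (E * B * C * D * xvar 1)"
    using const_term_regular_mult_xvar_1[OF regular] by simp
  also have "xvar 1 = xvar 1 ^ n * xpow 1 (- int n + 1)"
    by (simp only: xpow_power xpow_mult) (simp add: xvar_def)
  also have "const_term (to_laurent ?f * xpow 1 (- int n + 1) * B * C * D) +
      const_term (E * B * C * D * (xvar 1 ^ n * xpow 1 (- int n + 1))) =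
      const_term ((to_laurent ?f + E * xvar 1 ^ n) * xpow 1 (- int n + 1) * B * C * D)"
    by (simp add: const_term_add[symmetric] algebra_simps)
  also have "to_laurent ?f + E * xvar 1 ^ n =
      scal indet_P * inverse_one_plus_P_x1 * (1 + xvar 1) ^ 2"
    unfolding E_def by (rule inverse_truncated[symmetric])
  finally show "(\<Sum>a \<in> gog_with_bottom m n k b.
      indet_P ^ num_minima n k a * indet_Q ^ num_maxima_above_bottom m n k a) = const_term
      (scal indet_P * inverse_one_plus_P_x1 * (1 + xvar 1) ^ 2 * xpow 1 (- int n + 1) *
       (\<Prod>i\<in>{2..k}. (1 + xvar i) ^ b i * xpow i (- int n + 1)) *
       (\<Prod>i\<in>{k+1..n}. (1 + scal indet_Q * xvar i) * (1 + xvar i) ^ (m + k) *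
          xpow i (- int n + int i - int k)) *
       (\<Prod>(i, j) \<in> {(i, j). 1 \<le> i \<and> i < j \<and> j \<le> n}.
          (xvar i - xvar j) * (1 + xvar j + xvar i * xvar j)))"
    by (simp only: gog_sum_def B_def C_def D_def)
next
  fix b :: "nat \<Rightarrow> nat"
  assume b: "0 < b 1" "strict_mono_on {1..k} b" "b k \<le> m + k"
  \<comment> \<open>With \<open>p = 1\<close> the identity \<open>f_eq\<close> holds without error,
    and \<open>first_column\<close> is \<open>(1 + x_1)^(b 1)\<close> even for a leading entry
    1.\<close>
  interpret first_factor "1 + Var 1" 0 1 n
    by unfold_locales (simp_all add: only_var_def subst.ev_simps power2_eq_square)
  have "(\<Prod>i\<in>{1..k}. (1 + xvar i) ^ b i * xpow i (- int n + 1)) =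
      (1 + xvar 1) ^ b 1 * xpow 1 (- int n + 1) *
      (\<Prod>i\<in>{Suc 1..k}. (1 + xvar i) ^ b i * xpow i (- int n + 1))"
    using assms(1) by (rule prod.atLeast_Suc_atMost)
  moreover have "to_laurent (first_column (1 + Var 1) b) = (1 + xvar 1) ^ b 1"
    by (simp add: first_column_def scal.ev_simps)
  moreover have "gog_sum 1 m n k b = gog_coeff (1 + Var 1) m n k b"
    using assms b by (intro gog_sum_eq_gog_coeff) auto
  ultimately show "(\<Sum>a \<in> gog_with_bottom m n k b. indet_Q ^ num_maxima_above_bottom m n k a) =
      const_term
      ((\<Prod>i\<in>{1..k}. (1 + xvar i) ^ b i * xpow i (- int n + 1)) *
       (\<Prod>i\<in>{k+1..n}. (1 + scal indet_Q * xvar i) * (1 + xvar i) ^ (m + k) *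
          xpow i (- int n + int i - int k)) *
       (\<Prod>(i, j) \<in> {(i, j). 1 \<le> i \<and> i < j \<and> j \<le> n}.
          (xvar i - xvar j) * (1 + xvar j + xvar i * xvar j)))"
    by (simp only: gog_coeff_const_term[OF assms] gog_sum_def power_one mult_1_left Suc_1)
qed

end
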